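(* Let $G$ be a $p$-divisible group over $O_{K,\{1\}}=O_K/pO_K$ with an action of $O_F$, let $(\mathcal{F}_i^{[\bullet]})_{1\le i\le f}$ be adequate filtrations on the spaces $(\mathcal{E}_i)_{1\le i\le f}$, and let $w=\sum_{i=1}^f\sum_{j=1}^rw_i^{[j]}$. Assume that $w<1$, and let $({\mathcal{F}_i^{[\bullet]}}')_{1\le i\le f}$ be another adequate filtration on the spaces $(\mathcal{E}_i)_{1\le i\le f}$. Then $${\mathcal{F}_{i,\{1-w\}}^{[j]}}'=\mathcal{F}_{i,\{1-w\}}^{[j]}$$ (as submodules of $\mathcal{E}_{i,\{1-w\}}$) for all $1\le i\le f$ and $1\le j\le r$.
   Context: Setting. $F/\mathbb{Q}_p$ is a finite unramified extension of degree $f$, with ring of integers $O_F$ and residue field $k=\mathbb{F}_{p^f}$. The embeddings of $F$ are identified with $\mathbb{Z}/f\mathbb{Z}$ via powers of the Frobenius $\sigma$; indices $i$ are read modulo $f$. $K$ is an extension of $\mathbb{Q}_p$ with a (real-valued) valuation $v$ normalized by $v(p)=1$, with ring of integers $O_K$. For real $w>0$, $\mathfrak{m}_w=\{x\in O_K: v(x)\ge w\}$, $O_{K,\{w\}}=O_K/\mathfrak{m}_w$, and $M_{\{w\}}=M\otimes_{O_K}O_{K,\{w\}}$ for an $O_K$-module $M$. $O_K/p$ is assumed to be a $k$-algebra. $S=\operatorname{Spec}O_K/p$ and $G$ is a $p$-divisible group over $S$ of height $fh$ with an action of $O_F$. $\mathcal{E}=\bigoplus_{i=1}^f\mathcal{E}_i$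 is the contravariant Dieudonné crystal of $G$ evaluated at $S$, with $O_F$ acting on $\mathcal{E}_i$ (free of rank $h$) through $\sigma^i$. Frobenius and Verschiebung give $F_i:\mathcal{E}_{i-1}^{(p)}\to\mathcal{E}_i$ and $V_i:\mathcal{E}_i\to\mathcal{E}_{i-1}^{(p)}$. $\mathcal{F}_i=\omega_{G,i}\subset\mathcal{E}_i$ is the Hodge filtration, of rank $d_i$, and $\widetilde{\mathcal{F}}_i=\ker V_i=\operatorname{Im}F_i$; also $\mathcal{F}_{i-1}^{(p)}=\operatorname{Im}V_i=\ker F_i$. Let $\delta_1<\dots<\delta_r$ be the distinct elements of $\{d_i\}\cap[1,h-1]$, $\delta_0=0$, $\delta_{r+1}=h$, and define $s(i)\in\{0,\dots,r+1\}$ by $d_i=\delta_{s(i)}$. Adequate filtrations. These consist, for each $i$, of a filtration $$0\subset\mathcal{F}_i^{[s(i)-1]}\subset\dots\subset\mathcal{F}_i^{[1]}\subset\mathcal{F}_i\subset\mathcal{F}_i^{[r]}\subset\dots\subset\mathcal{F}_i^{[s(i)+1]}\subset\mathcal{E}_i$$ (only indices $1\le j\le r$ occur) with each $\mathcal{F}_i^{[j]}$ locally a direct factor of $\mathcal{E}_i$, of rank $d_i-\delta_j$ if $1\le j\le s(i)-1$ and of rank $h+d_i-\delta_j$ if $s(i)+1\le j\le r$. Set $\mathcal{F}_i^{[s(i)]}:=0$. Define $\widetilde{\mathcal{F}}_i^{[j]}:=V_i^{-1}((\mathcal{F}_{i-1}^{[j]})^{(p)})$ for $1\le j\le s(i-1)$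 and $\widetilde{\mathcal{F}}_i^{[j]}:=F_i((\mathcal{F}_{i-1}^{[j]})^{(p)})$ for $s(i-1)+1\le j\le r$. The filtrations are required to satisfy, for all $i$: $\mathcal{F}_i^{[j]}\subset\widetilde{\mathcal{F}}_i^{[j]}$ for $1\le j\le s(i)-1$, and $\widetilde{\mathcal{F}}_i^{[j]}\subset\mathcal{F}_i^{[j]}$ for $s(i)+1\le j\le r$. Valuations. $h_i^{[j]}$ is the determinant of the natural map $\mathcal{F}_i/\mathcal{F}_i^{[j]}\to\mathcal{E}_i/\widetilde{\mathcal{F}}_i^{[j]}$ if $1\le j\le s(i)$, and of $\widetilde{\mathcal{F}}_i^{[j]}\to\mathcal{F}_i^{[j]}/\mathcal{F}_i$ if $s(i)<j\le r$. Trivializing the invertible sheaf in which it lives, $w_i^{[j]}:=v(h_i^{[j]})\in[0,1]$, where for $x\in O_K/p$ one sets $v(x)=\min(v(\tilde x),1)$ for any lift $\tilde x\in O_K$. *)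

theory Defs
  imports
    "HOL-Analysis.Finite_Cartesian_Product"
    "HOL-Library.Extended_Real"
    "Jordan_Normal_Form.Determinant"
begin

section \<open>Valued fields\<close>

text \<open>Valuations are written additively, with \<open>v 0 = \<infinity>\<close>.\<close>

definition valuation :: "('a::field \<Rightarrow> ereal) \<Rightarrow> bool" where
  "valuation v \<longleftrightarrow>
     (\<forall>x. v x \<noteq> - \<infinity>) \<and> (\<forall>x. v x = \<infinity> \<longleftrightarrow> x = 0) \<and>
     (\<forall>x y. v (x * y) = v x + v y) \<and> (\<forall>x y. min (v x) (v y) \<le> v (x + y))"

definition val_ring :: "('a::field \<Rightarrow> ereal) \<Rightarrow> 'a set" where
  "val_ring v = {x. 0 \<le> v x}"

definition val_ideal :: "('a::field \<Rightarrow> ereal) \<Rightarrow> real \<Rightarrow> 'a set" where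
  "val_ideal v t = {x \<in> val_ring v. ereal t \<le> v x}"

text \<open>\<open>\<phi>\<close> presents the target ring as the quotient of the subring \<open>A\<close> by the ideal \<open>I\<close>;
  the values of \<open>\<phi>\<close> outside \<open>A\<close> are irrelevant.\<close>

definition quotient_map ::
  "'a::comm_ring_1 set \<Rightarrow> 'a set \<Rightarrow> ('a \<Rightarrow> 'b::comm_ring_1) \<Rightarrow> bool" where
  "quotient_map A I \<phi> \<longleftrightarrow>
     \<phi> 1 = 1 \<and> (\<forall>x\<in>A. \<forall>y\<in>A. \<phi> (x + y) = \<phi> x + \<phi> y \<and> \<phi> (x * y) = \<phi> x * \<phi> y) \<and>
     \<phi> ` A = UNIV \<and> {x \<in> A. \<phi> x = 0} = I"

text \<open>The field of \<open>p\<close>-adic numbers, as the completion of the rationals for a valuation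
  with \<open>v p = 1\<close>.\<close>

locale padic_numbers =
  fixes p :: nat and vQ :: "'q::field_char_0 \<Rightarrow> ereal"
  assumes prime_p: "prime p"
    and valuation_Q: "valuation vQ"
    and vQ_p: "vQ (of_nat p) = 1"
    and complete_Q: "\<And>X :: nat \<Rightarrow> 'q.
       (\<forall>B::real. \<exists>N. \<forall>m\<ge>N. \<forall>n\<ge>N. ereal B \<le> vQ (X m - X n)) \<Longrightarrow>
       \<exists>L. \<forall>B::real. \<exists>N. \<forall>n\<ge>N. ereal B \<le> vQ (X n - L)"
    and rationals_dense: "\<exists>q. ereal B \<le> vQ (x - of_rat q)"

locale valued_extension =
  fixes vQ :: "'q::field_char_0 \<Rightarrow> ereal"
    and j :: "'q \<Rightarrow> 'l::field_char_0" and v :: "'l \<Rightarrow> ereal"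
  assumes valuation_v: "valuation v"
    and hom_j: "field_hom j"
    and v_j: "v (j a) = vQ a"

text \<open>\<open>\<sigma>\<close> is the Frobenius automorphism of the unramified extension \<open>F\<close>, and \<open>res\<close> is the
  reduction map from the ring of integers of \<open>F\<close> to the residue field. The dimension is
  that of \<open>F\<close> over the base field; being positive, it is a finite dimension.\<close>

locale unramified_extension =
  padic_numbers p vQ + valued_extension vQ jF vF
  for p :: nat and vQ :: "'q::field_char_0 \<Rightarrow> ereal"
    and jF :: "'q \<Rightarrow> 'f::field_char_0" and vF :: "'f \<Rightarrow> ereal" +
  fixes f :: nat
    and res :: "'f \<Rightarrow> 'c::{field,finite}" and \<sigma> :: "'f \<Rightarrow> 'f"
  assumes f_pos: "0 < f"
    and degree: "vector_space.dim (\<lambda>a x. jF a * x) (UNIV :: 'f set) = f"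
    and unramified: "{x. 0 < vF x} = (\<lambda>x. of_nat p * x) ` val_ring vF"
    and residue_field: "quotient_map (val_ring vF) {x. 0 < vF x} res"
    and card_residue_field: "CARD('c) = p ^ f"
    and hom_\<sigma>: "field_hom \<sigma>" and bij_\<sigma>: "bij \<sigma>"
    and \<sigma>_base: "\<sigma> (jF a) = jF a"
    and vF_\<sigma>: "vF (\<sigma> x) = vF x"
    and res_\<sigma>: "x \<in> val_ring vF \<Longrightarrow> res (\<sigma> x) = res x ^ p"

text \<open>\<open>red\<close> presents \<open>'r\<close> as the ring of integers of \<open>K\<close> modulo \<open>p\<close>.\<close>

locale reduced_integers =
  padic_numbers p vQ + valued_extension vQ jK v
  for p :: nat and vQ :: "'q::field_char_0 \<Rightarrow> ereal"
    and jK :: "'q \<Rightarrow> 'k::field_char_0" and v :: "'k \<Rightarrow> ereal" +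
  fixes red :: "'k \<Rightarrow> 'r::comm_ring_1"
  assumes v_p: "v (of_nat p) = 1"
    and quotient_red: "quotient_map (val_ring v) ((\<lambda>x. of_nat p * x) ` val_ring v) red"

definition red_val :: "('k::field \<Rightarrow> ereal) \<Rightarrow> ('k \<Rightarrow> 'r::comm_ring_1) \<Rightarrow> 'r \<Rightarrow> real" where
  "red_val v red a = real_of_ereal (min (v (SOME x. x \<in> val_ring v \<and> red x = a)) 1)"


section \<open>Submodules of a free module\<close>

abbreviation submodule :: "('r::comm_ring_1 ^ 'n) set \<Rightarrow> bool" where
  "submodule \<equiv> module.subspace (*s)"

abbreviation rspan :: "('r::comm_ring_1 ^ 'n) set \<Rightarrow> ('r ^ 'n) set" where
  "rspan \<equiv> module.span (*s)"

definition free_of_rank :: "('r::comm_ring_1 ^ 'n) set \<Rightarrow> nat \<Rightarrow> bool" where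
  "free_of_rank M n \<longleftrightarrow>
     (\<exists>B. finite B \<and> card B = n \<and> \<not> module.dependent (*s) B \<and> rspan B = M)"

text \<open>The base ring below is local, so that ``locally a direct factor, of rank \<open>n\<close>'' means
  a direct factor which is free of rank \<open>n\<close>.\<close>

definition direct_factor ::
  "('r::comm_ring_1 ^ 'n) set \<Rightarrow> ('r ^ 'n) set \<Rightarrow> nat \<Rightarrow> bool" where
  "direct_factor M N n \<longleftrightarrow>
     free_of_rank N n \<and>
     (\<exists>C. submodule C \<and> N \<inter> C = {0} \<and> M = {x + y |x y. x \<in> N \<and> y \<in> C})"

definition direct_sum ::
  "nat \<Rightarrow> (nat \<Rightarrow> ('r::comm_ring_1 ^ 'n) set) \<Rightarrow> ('r ^ 'n) set \<Rightarrow> bool" where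
  "direct_sum f X M \<longleftrightarrow>
     (\<forall>i\<in>{1..f}. submodule (X i) \<and> X i \<subseteq> M) \<and>
     (\<forall>x\<in>M. \<exists>!y. (\<forall>i\<in>{1..f}. y i \<in> X i) \<and> (\<forall>i. i \<notin> {1..f} \<longrightarrow> y i = 0) \<and>
                  x = (\<Sum>i=1..f. y i))"

text \<open>\<open>u 0, \<dots>, u (n - 1)\<close> lie in \<open>M\<close> and their classes form a basis of \<open>M / N\<close>.\<close>

definition quotient_basis ::
  "('r::comm_ring_1 ^ 'n) set \<Rightarrow> ('r ^ 'n) set \<Rightarrow> nat \<Rightarrow> (nat \<Rightarrow> 'r ^ 'n) \<Rightarrow> bool" where
  "quotient_basis M N n u \<longleftrightarrow>
     (\<forall>a<n. u a \<in> M) \<and>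
     (\<forall>x\<in>M. \<exists>!c. (\<forall>a\<ge>n. c a = 0) \<and> x - (\<Sum>a<n. c a *s u a) \<in> N)"

text \<open>The determinant, for some choice of bases, of the map \<open>M / N \<rightarrow> M' / N'\<close> between free
  modules of rank \<open>n\<close> induced by the inclusions \<open>M \<subseteq> M'\<close> and \<open>N \<subseteq> N'\<close>. It is well defined
  up to a unit.\<close>

definition natural_det ::
  "('r::comm_ring_1 ^ 'n) set \<Rightarrow> ('r ^ 'n) set \<Rightarrow> ('r ^ 'n) set \<Rightarrow> ('r ^ 'n) set \<Rightarrow> nat \<Rightarrow> 'r" where
  "natural_det M N M' N' n =
     (SOME D. \<exists>u u' A. quotient_basis M N n u \<and> quotient_basis M' N' n u' \<and>
        A \<in> carrier_mat n n \<and>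
        (\<forall>b<n. u b - (\<Sum>a<n. A $$ (a, b) *s u' a) \<in> N') \<and>
        D = Determinant.det A)"

text \<open>The base change of \<open>R\<^sup>n\<close> along the Frobenius of \<open>R\<close> is again \<open>R\<^sup>n\<close>, with
  \<open>x \<otimes> 1\<close> corresponding to \<open>frob_vec p x\<close>. The twist of a direct factor \<open>N\<close> of \<open>R\<^sup>n\<close> embeds
  in it as the submodule generated by the image of \<open>N\<close>, and the twist of a linear map with matrix
  \<open>A\<close> has matrix \<open>frob_mat p A\<close>.\<close>

definition frob_vec :: "nat \<Rightarrow> 'r::comm_ring_1 ^ 'n \<Rightarrow> 'r ^ 'n" where
  "frob_vec p x = (\<chi> a. vec_nth x a ^ p)"

definition frob_mat :: "nat \<Rightarrow> 'r::comm_ring_1 ^ 'n ^ 'm \<Rightarrow> 'r ^ 'n ^ 'm" where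
  "frob_mat p A = (\<chi> a b. vec_nth (vec_nth A a) b ^ p)"

definition twist :: "nat \<Rightarrow> ('r::comm_ring_1 ^ 'n) set \<Rightarrow> ('r ^ 'n) set" where
  "twist p N = rspan (frob_vec p ` N)"

text \<open>The image of \<open>N\<close> in the reduction of \<open>M\<close> modulo the elements of valuation at least \<open>t\<close>,
  as a set of cosets.\<close>

definition ideal_times ::
  "('k::field \<Rightarrow> ereal) \<Rightarrow> ('k \<Rightarrow> 'r::comm_ring_1) \<Rightarrow> real \<Rightarrow> ('r ^ 'n) set \<Rightarrow> ('r ^ 'n) set" where
  "ideal_times v red t M = rspan {red a *s x |a x. a \<in> val_ideal v t \<and> x \<in> M}"

definition reduction ::
  "('k::field \<Rightarrow> ereal) \<Rightarrow> ('k \<Rightarrow> 'r::comm_ring_1) \<Rightarrow> real \<Rightarrow>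
   ('r ^ 'n) set \<Rightarrow> ('r ^ 'n) set \<Rightarrow> ('r ^ 'n) set set" where
  "reduction v red t M N = (\<lambda>x. {x + y |y. y \<in> ideal_times v red t M}) ` N"


section \<open>Dieudonne modules with an action of the ring of integers of \<open>F\<close>\<close>

text \<open>The embedding of \<open>F\<close> with index \<open>i\<close> is the \<open>i\<close>-th power of \<open>\<sigma>\<close>; its reduction makes
  the ring of integers of \<open>F\<close> act on modules over the \<open>k\<close>-algebra \<open>'r\<close> by scalars.\<close>

definition isotypic ::
  "('f::field \<Rightarrow> ereal) \<Rightarrow> ('f \<Rightarrow> 'f) \<Rightarrow> ('f \<Rightarrow> 'c::field) \<Rightarrow> ('c \<Rightarrow> 'r::comm_ring_1) \<Rightarrow>
   ('f \<Rightarrow> 'r ^ 'n ^ 'n) \<Rightarrow> nat \<Rightarrow> ('r ^ 'n) set" where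
  "isotypic vF \<sigma> res \<kappa> \<rho> i =
     {x. \<forall>a\<in>val_ring vF. \<rho> a *v x = \<kappa> (res ((\<sigma> ^^ i) a)) *s x}"

text \<open>The structure carried by the contravariant Dieudonne crystal, evaluated at the base
  \<open>S = Spec 'r\<close>, of a \<open>p\<close>-divisible group \<open>G\<close> with an action of the ring of integers of \<open>F\<close>:
  a free module \<open>R\<^sup>n\<close> whose rank is the height of \<open>G\<close>, with its Frobenius \<open>Fr\<close> (defined on the
  Frobenius twist), its Verschiebung \<open>Ve\<close> (with values in the twist), its Hodge filtration \<open>\<omega>\<close>
  and the induced action \<open>\<rho>\<close>. The group \<open>G\<close> itself is not represented; modules satisfying these
  conditions need not come from one. \<open>E i\<close> and \<open>H i\<close> are the \<open>i\<close>-th components of \<open>R\<^sup>n\<close>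
  and of \<open>\<omega>\<close>, and \<open>E f\<close> is the component of index \<open>0\<close> modulo \<open>f\<close>.\<close>

locale dieudonne_module =
  unramified_extension p vQ jF vF f res \<sigma> + K: reduced_integers p vQ jK v red
  for p :: nat and vQ :: "'q::field_char_0 \<Rightarrow> ereal"
    and jF :: "'q \<Rightarrow> 'f::field_char_0" and vF :: "'f \<Rightarrow> ereal" and f :: nat
    and res :: "'f \<Rightarrow> 'c::{field,finite}" and \<sigma> :: "'f \<Rightarrow> 'f"
    and jK :: "'q \<Rightarrow> 'k::field_char_0" and v :: "'k \<Rightarrow> ereal"
    and red :: "'k \<Rightarrow> 'r::comm_ring_1" +
  fixes \<kappa> :: "'c \<Rightarrow> 'r"
    and Fr Ve :: "'r ^ 'n ^ 'n" and \<omega> :: "('r ^ 'n) set" and \<rho> :: "'f \<Rightarrow> 'r ^ 'n ^ 'n"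
    and h :: nat and d :: "nat \<Rightarrow> nat" and E H :: "nat \<Rightarrow> ('r ^ 'n) set"
  assumes k_algebra: "comm_ring_hom \<kappa>"
    and height: "CARD('n) = f * h"
    and submodule_\<omega>: "submodule \<omega>"
    and kernel_Fr: "{x. Fr *v x = 0} = twist p \<omega>"
    and image_Ve: "range ((*v) Ve) = twist p \<omega>"
    and kernel_Ve: "{x. Ve *v x = 0} = range ((*v) Fr)"
    and \<rho>_one: "\<rho> 1 = Finite_Cartesian_Product.mat 1"
    and \<rho>_add: "a \<in> val_ring vF \<Longrightarrow> b \<in> val_ring vF \<Longrightarrow> \<rho> (a + b) = \<rho> a + \<rho> b"
    and \<rho>_mult: "a \<in> val_ring vF \<Longrightarrow> b \<in> val_ring vF \<Longrightarrow> \<rho> (a * b) = \<rho> a ** \<rho> b"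
    and \<rho>_Fr: "a \<in> val_ring vF \<Longrightarrow> \<rho> a ** Fr = Fr ** frob_mat p (\<rho> a)"
    and \<rho>_Ve: "a \<in> val_ring vF \<Longrightarrow> frob_mat p (\<rho> a) ** Ve = Ve ** \<rho> a"
    and \<rho>_\<omega>: "a \<in> val_ring vF \<Longrightarrow> x \<in> \<omega> \<Longrightarrow> \<rho> a *v x \<in> \<omega>"
    and E_def: "E = isotypic vF \<sigma> res \<kappa> \<rho>"
    and H_def: "H = (\<lambda>i. \<omega> \<inter> E i)"
    and sum_E: "direct_sum f E UNIV"
    and sum_H: "direct_sum f H \<omega>"
    and free_E: "i \<in> {1..f} \<Longrightarrow> free_of_rank (E i) h"
    and factor_H: "i \<in> {1..f} \<Longrightarrow> direct_factor (E i) (H i) (d i)"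


section \<open>Adequate filtrations\<close>

text \<open>\<open>prv f i\<close> is the index \<open>i - 1\<close> modulo \<open>f\<close>, with representatives \<open>1, \<dots>, f\<close>.\<close>

definition prv :: "nat \<Rightarrow> nat \<Rightarrow> nat" where
  "prv f i = (if i = 1 then f else i - 1)"

definition jump_list :: "nat \<Rightarrow> nat \<Rightarrow> (nat \<Rightarrow> nat) \<Rightarrow> nat list" where
  "jump_list f h d = sorted_list_of_set (d ` {1..f} \<inter> {1..h - 1})"

definition jump_count :: "nat \<Rightarrow> nat \<Rightarrow> (nat \<Rightarrow> nat) \<Rightarrow> nat" where
  "jump_count f h d = length (jump_list f h d)"

definition jump :: "nat \<Rightarrow> nat \<Rightarrow> (nat \<Rightarrow> nat) \<Rightarrow> nat \<Rightarrow> nat" where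
  "jump f h d j =
     (if j = 0 then 0 else if j \<le> jump_count f h d then jump_list f h d ! (j - 1) else h)"

definition jump_index :: "nat \<Rightarrow> nat \<Rightarrow> (nat \<Rightarrow> nat) \<Rightarrow> nat \<Rightarrow> nat" where
  "jump_index f h d i = (THE s. s \<le> jump_count f h d + 1 \<and> d i = jump f h d s)"

text \<open>Pulls \<open>Fil (i - 1) j\<close> back along Verschiebung, or pushes it forward along Frobenius,
  into \<open>E i\<close>.\<close>

definition fil_tilde ::
  "nat \<Rightarrow> nat \<Rightarrow> nat \<Rightarrow> (nat \<Rightarrow> nat) \<Rightarrow> 'r::comm_ring_1 ^ 'n ^ 'n \<Rightarrow> 'r ^ 'n ^ 'n \<Rightarrow>
   (nat \<Rightarrow> ('r ^ 'n) set) \<Rightarrow> (nat \<Rightarrow> nat \<Rightarrow> ('r ^ 'n) set) \<Rightarrow> nat \<Rightarrow> nat \<Rightarrow> ('r ^ 'n) set" where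
  "fil_tilde p f h d Fr Ve E Fil i j =
     (if j \<le> jump_index f h d (prv f i)
      then {x \<in> E i. Ve *v x \<in> twist p (Fil (prv f i) j)}
      else (\<lambda>x. Fr *v x) ` twist p (Fil (prv f i) j))"

text \<open>The value \<open>Fil i (s i)\<close>, which is not part of the filtration, is fixed by convention.
  All conditions concern indices \<open>1 \<le> i \<le> f\<close> and \<open>1 \<le> j \<le> r\<close> only.\<close>

definition adequate ::
  "nat \<Rightarrow> nat \<Rightarrow> nat \<Rightarrow> (nat \<Rightarrow> nat) \<Rightarrow> 'r::comm_ring_1 ^ 'n ^ 'n \<Rightarrow> 'r ^ 'n ^ 'n \<Rightarrow>
   (nat \<Rightarrow> ('r ^ 'n) set) \<Rightarrow> (nat \<Rightarrow> ('r ^ 'n) set) \<Rightarrow> (nat \<Rightarrow> nat \<Rightarrow> ('r ^ 'n) set) \<Rightarrow> bool" where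
  "adequate p f h d Fr Ve E H Fil \<longleftrightarrow>
     (let r = jump_count f h d; \<delta> = jump f h d; s = jump_index f h d;
          Fil' = fil_tilde p f h d Fr Ve E Fil in
      \<forall>i\<in>{1..f}.
        (s i \<in> {1..r} \<longrightarrow> Fil i (s i) = {0}) \<and>
        (\<forall>j\<in>{1..r}. j < s i \<longrightarrow>
           direct_factor (E i) (Fil i j) (d i - \<delta> j) \<and> Fil i j \<subseteq> H i \<and>
           (\<forall>j'\<in>{1..j}. Fil i j \<subseteq> Fil i j') \<and>
           Fil i j \<subseteq> Fil' i j) \<and>
        (\<forall>j\<in>{1..r}. s i < j \<longrightarrow>
           direct_factor (E i) (Fil i j) (h + d i - \<delta> j) \<and> H i \<subseteq> Fil i j \<and>
           (\<forall>j'\<in>{j..r}. Fil i j' \<subseteq> Fil i j) \<and>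
           Fil' i j \<subseteq> Fil i j))"

definition hasse_det ::
  "nat \<Rightarrow> nat \<Rightarrow> nat \<Rightarrow> (nat \<Rightarrow> nat) \<Rightarrow> 'r::comm_ring_1 ^ 'n ^ 'n \<Rightarrow> 'r ^ 'n ^ 'n \<Rightarrow>
   (nat \<Rightarrow> ('r ^ 'n) set) \<Rightarrow> (nat \<Rightarrow> ('r ^ 'n) set) \<Rightarrow> (nat \<Rightarrow> nat \<Rightarrow> ('r ^ 'n) set) \<Rightarrow>
   nat \<Rightarrow> nat \<Rightarrow> 'r" where
  "hasse_det p f h d Fr Ve E H Fil i j =
     (if j \<le> jump_index f h d i
      then natural_det (H i) (Fil i j) (E i) (fil_tilde p f h d Fr Ve E Fil i j) (jump f h d j)
      else natural_det (fil_tilde p f h d Fr Ve E Fil i j) {0} (Fil i j) (H i)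
             (h - jump f h d j))"

end

theory Submission
  imports Defs "HOL-Computational_Algebra.Primes"
begin

text \<open>Call two submodules congruent to precision \<open>t\<close> if each lies in the other up to vectors whose
  coordinates have valuation at least \<open>t\<close>. Fix \<open>j\<close>. At an index \<open>i0\<close> with \<open>s i0 = j\<close> both filtrations
  are \<open>0\<close>, so they agree to precision \<open>1\<close>. Passing from \<open>i - 1\<close> to \<open>i\<close>, the twist does not decrease the
  precision \<open>t\<close>, hence the modules \<open>tilde Fil i j\<close> and \<open>tilde Fil' i j\<close> agree to precision \<open>t\<close>, and
  Cramer's rule for the map whose determinant is the partial Hasse invariant shows that \<open>Fil i j\<close> and
  \<open>Fil' i j\<close> agree to precision \<open>t - w i j\<close>. Going once around the cycle loses at most \<open>w\<close>.
  The inclusion in one direction suffices at each step, because both submodules are direct factors of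
  the same rank over a local ring.\<close>

text \<open>The ring \<open>'r\<close> is O_K/p: local, but in general with nilpotents, so Cramer's
  rule cannot end by dividing by the determinant D. It ends with the truncated valuation instead: t
  \<le> \<nu> (D * c) = min (\<nu> D + \<nu> c) 1 gives t - \<nu> D \<le> \<nu> c, which is exactly
  the loss w i j. Positivity of the precision, guaranteed by w < 1, matters because reversing an
  inclusion amounts to comparing the two modules over the residue field. \<open>natural_det\<close>
  is a \<open>SOME\<close>, so it carries information only once bases of the right length are known
  to exist on both sides. Producing them for \<open>tilde Fil i j\<close> is where the Dieudonne
  module enters: exactness of \<open>Fr\<close> and \<open>Ve\<close> on all of R^n has to be split
  along the components \<open>E i\<close>, and this rests on distinct embeddings taking, at a
  suitable element, values whose difference is a unit. Direct factors are handled through a basis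
  with a dual family of vectors. Such data pass to the Frobenius twist entrywise and bound the
  coordinates of small vectors.\<close>

interpretation rmod: Modules.module "(*s) :: 'r::comm_ring_1 \<Rightarrow> 'r ^ 'n \<Rightarrow> 'r ^ 'n"
  by standard (simp_all add: vector_add_ldistrib vector_sadd_rdistrib vector_smult_assoc)

lemma module_hom_matrix: "module_hom (*s) (*s) ((*v) (A :: 'r::comm_ring_1 ^ 'n ^ 'm))"
  by unfold_locales (simp_all add: Finite_Cartesian_Product.vec_eq_iff matrix_vector_mult_def sum_distrib_left mult.left_commute distrib_left sum.distrib)

lemmas matrix_vector_sum = module_hom.sum[OF module_hom_matrix]
lemmas matrix_vector_scale = module_hom.scale[OF module_hom_matrix]
lemmas matrix_vector_diff = module_hom.diff[OF module_hom_matrix]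
lemmas matrix_vector_add = module_hom.add[OF module_hom_matrix]
lemmas submodule_image = module_hom.subspace_image[OF module_hom_matrix]
lemmas span_matrix_image = module_hom.span_image[OF module_hom_matrix]

lemma vec_axis_expand: "(x :: 'r::comm_ring_1 ^ 'n) = (\<Sum>k\<in>UNIV. vec_nth x k *s axis k 1)"
  by (simp add: Finite_Cartesian_Product.vec_eq_iff axis_def if_distrib[of "(*) _"] mult_ac cong: if_cong)

text \<open>Linear maps are turned into matrices because the twist of a map is available only as
  \<open>frob_mat\<close> of a matrix; the projections onto the components are twisted this
  way.\<close>

lemma matrix_of_linear:
  fixes g :: "'r::comm_ring_1 ^ 'n \<Rightarrow> 'r ^ 'm"
  assumes "module_hom (*s) (*s) g"
  obtains A where "\<And>x. A *v x = g x"
proof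
  interpret module_hom "(*s)" "(*s)" g by fact
  fix x :: "'r ^ 'n"
  have "g x = (\<Sum>k\<in>UNIV. vec_nth x k *s g (axis k 1))"
    by (subst vec_axis_expand[of x]) (simp add: sum scale)
  also have "\<dots> = (\<chi> a b. vec_nth (g (axis b 1)) a) *v x"
    by (simp add: Finite_Cartesian_Product.vec_eq_iff matrix_vector_mult_def mult.commute)
  finally show "(\<chi> a b. vec_nth (g (axis b 1)) a) *v x = g x" ..
qed

section \<open>Bases of quotients\<close>

text \<open>The definition asks for one unique coefficient function on all naturals, normalised to
  vanish from \<open>n\<close> on. Here generation and independence are separated and the
  normalisation is absorbed by truncating.\<close>

lemma quotient_basisI:
  assumes "submodule N" "\<And>a. a < n \<Longrightarrow> u a \<in> M"
    and ex: "\<And>x. x \<in> M \<Longrightarrow> \<exists>c. x - (\<Sum>a<n. c a *s u a) \<in> N"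
    and un: "\<And>c a. (\<Sum>a<n. c a *s u a) \<in> N \<Longrightarrow> a < n \<Longrightarrow> c a = 0"
  shows "quotient_basis M N n u"
  unfolding quotient_basis_def
proof (intro conjI allI impI ballI)
  fix x assume "x \<in> M"
  then obtain c where c: "x - (\<Sum>a<n. c a *s u a) \<in> N" using ex by blast
  show "\<exists>!c. (\<forall>a\<ge>n. c a = 0) \<and> x - (\<Sum>a<n. c a *s u a) \<in> N"
  proof (rule ex1I[of _ "\<lambda>a. if a < n then c a else 0"])
    have "(\<Sum>a<n. (if a < n then c a else 0) *s u a) = (\<Sum>a<n. c a *s u a)"
      by (rule sum.cong) auto
    then show "(\<forall>a\<ge>n. (if a < n then c a else 0) = 0) \<and> x - (\<Sum>a<n. (if a < n then c a else 0) *s u a) \<in> N"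
      using c by simp
  next
    fix c' assume c': "(\<forall>a\<ge>n. c' a = 0) \<and> x - (\<Sum>a<n. c' a *s u a) \<in> N"
    have "(x - (\<Sum>a<n. c' a *s u a)) - (x - (\<Sum>a<n. c a *s u a)) \<in> N"
      by (rule rmod.subspace_diff[OF assms(1)]) (use c c' in blast)+
    also have "(x - (\<Sum>a<n. c' a *s u a)) - (x - (\<Sum>a<n. c a *s u a)) = (\<Sum>a<n. (c a - c' a) *s u a)"
      by (simp add: vector_sub_rdistrib sum_subtractf)
    finally have "c a - c' a = 0" if "a < n" for a
      using un[of "\<lambda>a. c a - c' a", OF _ that] by simp
    then show "c' = (\<lambda>a. if a < n then c a else 0)" using c' by (auto simp: fun_eq_iff)
  qed
qed fact

lemma quotient_basis_mem: "quotient_basis M N n u \<Longrightarrow> a < n \<Longrightarrow> u a \<in> M"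
  by (simp add: quotient_basis_def)

lemma quotient_basis_coords:
  assumes "quotient_basis M N n u" "x \<in> M"
  obtains c where "x - (\<Sum>a<n. c a *s u a) \<in> N"
proof -
  have "\<exists>!c. (\<forall>a\<ge>n. c a = 0) \<and> x - (\<Sum>a<n. c a *s u a) \<in> N"
    using assms unfolding quotient_basis_def by simp
  then show ?thesis by (elim ex1E conjE) (rule that)
qed

lemma ex1_eq: "\<exists>!x. P x \<Longrightarrow> P a \<Longrightarrow> P b \<Longrightarrow> a = b"
  by blast

lemma quotient_basis_indep:
  assumes "quotient_basis M N n u" "submodule M" "submodule N"
    and "(\<Sum>a<n. c a *s u a) \<in> N" "a < n"
  shows "c a = 0"
proof -
  let ?c = "\<lambda>a. if a < n then c a else 0"
  define Q where "Q c \<longleftrightarrow> (\<forall>a\<ge>n. c a = 0) \<and> 0 - (\<Sum>a<n. c a *s u a) \<in> N" for c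
  have "\<exists>!c. Q c"
    using assms(1) rmod.subspace_0[OF assms(2)] unfolding quotient_basis_def Q_def by blast
  moreover have "(\<Sum>a<n. ?c a *s u a) = (\<Sum>a<n. c a *s u a)"
    by (rule sum.cong) auto
  then have "Q ?c"
    using rmod.subspace_neg[OF assms(3,4)] by (simp add: Q_def)
  moreover have "Q (\<lambda>_. 0)"
    using rmod.subspace_0[OF assms(3)] by (simp add: Q_def)
  ultimately have "?c = (\<lambda>_. 0)" by (rule ex1_eq[of Q])
  from fun_cong[OF this, of a] show ?thesis using assms(5) by simp
qed

text \<open>M/N is an extension of M/P by P/N, and a basis of the quotient followed by one of the
  submodule is a basis of the extension.\<close>

lemma quotient_basis_trans:
  assumes "submodule N" "submodule P" "submodule M" "N \<subseteq> P" "P \<subseteq> M"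
    and u: "quotient_basis M P m u" and u': "quotient_basis P N n u'"
  shows "quotient_basis M N (m + n) (\<lambda>a. if a < m then u a else u' (a - m))"
proof -
  let ?w = "\<lambda>a. if a < m then u a else u' (a - m)"
  have split: "(\<Sum>a<m+k. c a *s ?w a) = (\<Sum>a<m. c a *s u a) + (\<Sum>a<k. c (m + a) *s u' a)" for c k
    by (induction k) (simp_all add: add.assoc)
  show ?thesis
  proof (rule quotient_basisI)
    fix a assume "a < m + n" then show "?w a \<in> M"
      using quotient_basis_mem[OF u, of a] quotient_basis_mem[OF u', of "a - m"] assms by auto
  next
    fix x assume "x \<in> M"
    then obtain c where "x - (\<Sum>a<m. c a *s u a) \<in> P" by (rule quotient_basis_coords[OF u])
    then obtain c' where c': "x - (\<Sum>a<m. c a *s u a) - (\<Sum>a<n. c' a *s u' a) \<in> N"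
      by (rule quotient_basis_coords[OF u'])
    let ?d = "\<lambda>a. if a < m then c a else c' (a - m)"
    have "(\<Sum>a<m+n. ?d a *s ?w a) = (\<Sum>a<m. c a *s u a) + (\<Sum>a<n. c' a *s u' a)"
      unfolding split by (intro arg_cong2[where f="(+)"] sum.cong) auto
    then show "\<exists>c. x - (\<Sum>a<m+n. c a *s ?w a) \<in> N" using c'
      by (intro exI[of _ ?d]) (simp only: diff_diff_eq)
  next
    fix c a assume *: "(\<Sum>a<m+n. c a *s ?w a) \<in> N" and a: "a < m + n"
    have P: "(\<Sum>a<n. c (m + a) *s u' a) \<in> P"
      by (intro rmod.subspace_sum rmod.subspace_scale assms) (use quotient_basis_mem[OF u'] in auto)
    have "(\<Sum>a<m. c a *s u a) + (\<Sum>a<n. c (m + a) *s u' a) \<in> P" using * assms split by auto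
    from rmod.subspace_diff[OF assms(2) this P] have "(\<Sum>a<m. c a *s u a) \<in> P" by simp
    then have z: "c a = 0" if "a < m" for a
      by (rule quotient_basis_indep[OF u assms(3,2) _ that])
    then have "(\<Sum>a<m. c a *s u a) = 0" by (intro sum.neutral) auto
    then have "(\<Sum>a<n. c (m + a) *s u' a) \<in> N" using * split by simp
    then have "c (m + a) = 0" if "a < n" for a
      by (rule quotient_basis_indep[OF u' assms(2,1) _ that])
    from this[of "a - m"] z[of a] show "c a = 0" using a by (cases "a < m") auto
  qed fact
qed

text \<open>\<open>A\<close> induces an isomorphism of M/N onto P/Q, through which the basis is
  lifted.\<close>

lemma quotient_basis_vimage:
  assumes "submodule M" "submodule Q" and P: "(*v) A ` M = P"
    and u: "quotient_basis P Q n u" and N: "N = {x \<in> M. A *v x \<in> Q}"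
  obtains u' where "quotient_basis M N n u'"
proof -
  have "\<exists>y\<in>M. A *v y = u a" if "a < n" for a
    using quotient_basis_mem[OF u that] by (simp only: P[symmetric]) (elim imageE, auto)
  then obtain y where y: "\<And>a. a < n \<Longrightarrow> y a \<in> M \<and> A *v y a = u a" by metis
  have img: "A *v (\<Sum>a<n. c a *s y a) = (\<Sum>a<n. c a *s u a)" for c
    unfolding matrix_vector_sum matrix_vector_scale by (rule sum.cong) (simp_all add: y)
  have inM: "(\<Sum>a<n. c a *s y a) \<in> M" for c
    by (intro rmod.subspace_sum rmod.subspace_scale assms) (use y in auto)
  have sN: "submodule N" unfolding N
    using assms(1,2) by (auto simp: rmod.subspace_def matrix_vector_add matrix_vector_scale)
  have sP: "submodule P" using submodule_image[OF assms(1), of A] P by simp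
  have "quotient_basis M N n y"
  proof (rule quotient_basisI[OF sN])
    show "y a \<in> M" if "a < n" for a using y that by blast
    fix x assume x: "x \<in> M"
    then have "A *v x \<in> P" using P by blast
    then obtain c where "A *v x - (\<Sum>a<n. c a *s u a) \<in> Q" by (rule quotient_basis_coords[OF u])
    then have "A *v (x - (\<Sum>a<n. c a *s y a)) \<in> Q" by (simp add: matrix_vector_diff img)
    with rmod.subspace_diff[OF assms(1) x inM, of c] show "\<exists>c. x - (\<Sum>a<n. c a *s y a) \<in> N"
      unfolding N by (intro exI[of _ c]) simp
  next
    fix c a assume *: "(\<Sum>a<n. c a *s y a) \<in> N" and a: "a < n"
    have "(\<Sum>a<n. c a *s u a) \<in> Q" using * by (simp add: N img)
    then show "c a = 0" by (rule quotient_basis_indep[OF u sP assms(2) _ a])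
  qed
  then show ?thesis by (rule that)
qed

text \<open>Since the kernel of \<open>A\<close> on \<open>P\<close> lies in \<open>Q\<close>,
  passing to images does not change the quotient P/Q.\<close>

lemma quotient_basis_image:
  assumes "submodule P" "submodule Q" "Q \<subseteq> P" and ker: "\<And>x. x \<in> P \<Longrightarrow> A *v x = 0 \<Longrightarrow> x \<in> Q"
    and u: "quotient_basis P Q n u"
  shows "quotient_basis ((*v) A ` P) ((*v) A ` Q) n (\<lambda>a. A *v u a)"
proof (rule quotient_basisI)
  have img: "A *v (\<Sum>a<n. c a *s u a) = (\<Sum>a<n. c a *s (A *v u a))" for c
    by (simp add: matrix_vector_sum matrix_vector_scale)
  show "submodule ((*v) A ` Q)" by (rule submodule_image[OF assms(2)])
  show "A *v u a \<in> (*v) A ` P" if "a < n" for a using quotient_basis_mem[OF u that] by blast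
  show "\<exists>c. x - (\<Sum>a<n. c a *s (A *v u a)) \<in> (*v) A ` Q" if "x \<in> (*v) A ` P" for x
  proof -
    from that obtain y where "y \<in> P" and x: "x = A *v y" by (elim imageE) simp
    obtain c where c: "y - (\<Sum>a<n. c a *s u a) \<in> Q" by (rule quotient_basis_coords[OF u \<open>y \<in> P\<close>])
    have "A *v (y - (\<Sum>a<n. c a *s u a)) = A *v y - (\<Sum>a<n. c a *s (A *v u a))"
      by (simp only: matrix_vector_diff img)
    with imageI[OF c, of "(*v) A"] show ?thesis by (simp only: x) (rule exI)
  qed
  fix c a assume "(\<Sum>a<n. c a *s (A *v u a)) \<in> (*v) A ` Q" and a: "a < n"
  then obtain q where q: "q \<in> Q" "A *v (\<Sum>a<n. c a *s u a) = A *v q"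
    unfolding img by (elim imageE) simp
  have "(\<Sum>a<n. c a *s u a) \<in> P"
    by (intro rmod.subspace_sum rmod.subspace_scale assms) (use quotient_basis_mem[OF u] in auto)
  then have "(\<Sum>a<n. c a *s u a) - q \<in> Q"
    using q assms(3) by (intro ker rmod.subspace_diff[OF assms(1)]) (auto simp: matrix_vector_diff)
  then have "(\<Sum>a<n. c a *s u a) \<in> Q"
    using rmod.subspace_add[OF assms(2) _ q(1), of "(\<Sum>a<n. c a *s u a) - q"] by simp
  then show "c a = 0" by (rule quotient_basis_indep[OF u assms(1,2) _ a])
qed

section \<open>Split submodules\<close>

text \<open>Functionals on R^n are represented by vectors through this pairing, so that they too can
  be twisted by \<open>frob_vec\<close>.\<close>

definition vdot :: "'r::comm_ring_1 ^ 'n \<Rightarrow> 'r ^ 'n \<Rightarrow> 'r" where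
  "vdot x y = (\<Sum>k\<in>UNIV. vec_nth x k * vec_nth y k)"

lemma vdot_add_right: "vdot x (y + z) = vdot x y + vdot x z"
  and vdot_scale_right: "vdot x (c *s y) = c * vdot x y"
  and vdot_diff_right: "vdot x (y - z) = vdot x y - vdot x z"
  and vdot_zero_right [simp]: "vdot x 0 = 0"
  and vdot_diff_left: "vdot (x - y) z = vdot x z - vdot y z"
  and vdot_scale_left: "vdot (c *s x) y = c * vdot x y"
  by (simp_all add: vdot_def algebra_simps sum.distrib sum_subtractf sum_distrib_left)

lemma vdot_sum_right: "vdot x (\<Sum>i\<in>S. g i) = (\<Sum>i\<in>S. vdot x (g i))"
  by (induction S rule: infinite_finite_induct) (simp_all add: vdot_add_right)

definition dual_on :: "('r::comm_ring_1 ^ 'n) set \<Rightarrow> ('r ^ 'n \<Rightarrow> 'r ^ 'n) \<Rightarrow> bool" where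
  "dual_on S \<mu> \<longleftrightarrow> (\<forall>b\<in>S. \<forall>c\<in>S. vdot (\<mu> b) c = (if b = c then 1 else 0))"

text \<open>The dual family makes x \<mapsto> \<Sum> (vdot (\<mu> s) x) s a projection of R^n onto
  \<open>N\<close>: this is a free direct factor of the whole of R^n, with the splitting recorded by
  vectors.\<close>

definition split_module :: "('r::comm_ring_1 ^ 'n) set \<Rightarrow> nat \<Rightarrow> bool" where
  "split_module N k \<longleftrightarrow> (\<exists>S \<mu>. finite S \<and> card S = k \<and> dual_on S \<mu> \<and> rspan S = N)"

lemma split_module_submodule: "split_module N k \<Longrightarrow> submodule N"
  unfolding split_module_def by (elim exE conjE) (drule sym, simp)

lemma dual_on_coord:
  assumes "finite S" "dual_on S \<mu>" "b \<in> S"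
  shows "vdot (\<mu> b) (\<Sum>s\<in>S. c s *s s) = c b"
proof -
  have "vdot (\<mu> b) (\<Sum>s\<in>S. c s *s s) = (\<Sum>s\<in>S. if b = s then c s else 0)"
    unfolding vdot_sum_right vdot_scale_right
    by (rule sum.cong) (use assms in \<open>auto simp: dual_on_def\<close>)
  then show ?thesis using assms by simp
qed

lemma dual_on_expand:
  assumes "finite S" "dual_on S \<mu>" "x \<in> rspan S"
  shows "x = (\<Sum>s\<in>S. vdot (\<mu> s) x *s s)"
proof -
  obtain c where x: "x = (\<Sum>s\<in>S. c s *s s)"
    using assms(3) unfolding rmod.span_finite[OF assms(1)] by (elim imageE)
  show ?thesis
    by (subst (1) x, rule sum.cong) (simp_all add: x dual_on_coord[OF assms(1,2)])
qed

text \<open>The Steinitz step: \<open>s\<close> may be replaced by \<open>b\<close> once the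
  \<open>s\<close>-coordinate of \<open>b\<close> is invertible, with inverse
  \<open>y\<close>.\<close>

lemma dual_on_swap:
  assumes "finite S" and \<mu>: "dual_on S \<mu>" and b: "b \<in> rspan S" and s: "s \<in> S"
    and y: "vdot (\<mu> s) b * y = 1"
  shows "b \<notin> S - {s}" and "\<exists>\<mu>'. dual_on (insert b (S - {s})) \<mu>'"
    and "rspan (insert b (S - {s})) = rspan S"
proof -
  show b': "b \<notin> S - {s}"
  proof
    assume "b \<in> S - {s}"
    then have "vdot (\<mu> s) b = 0" using \<mu> s unfolding dual_on_def by auto
    with y show False by simp
  qed
  have d: "vdot (\<mu> x) z = (if x = z then 1 else 0)" if "x \<in> S" "z \<in> S" for x z
    using \<mu> that unfolding dual_on_def by blast
  \<comment> \<open>The functional of \<open>s\<close>, rescaled by \<open>y\<close>, becomes that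
    of \<open>b\<close>; each other functional is corrected by the multiple of
    \<open>\<mu> s\<close> that makes it vanish on \<open>b\<close>.\<close>
  let ?\<mu> = "\<lambda>x. if x = b then y *s \<mu> s else \<mu> x - (vdot (\<mu> x) b * y) *s \<mu> s"
  have "vdot (\<mu> x) b * y * vdot (\<mu> s) b = vdot (\<mu> x) b" for x
    using y by (metis mult.assoc mult.commute mult.right_neutral)
  then have "dual_on (insert b (S - {s})) ?\<mu>"
    using y s b' by (auto simp: dual_on_def vdot_scale_left vdot_diff_left d mult.commute)
  then show "\<exists>\<mu>'. dual_on (insert b (S - {s})) \<mu>'" by blast
  let ?T = "insert b (S - {s})"
  define r where "r = (\<Sum>t\<in>S-{s}. vdot (\<mu> t) b *s t)"
  have "b = vdot (\<mu> s) b *s s + r" unfolding r_def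
    by (subst dual_on_expand[OF assms(1) \<mu> b]) (rule sum.remove[OF assms(1) s])
  then have "b - r = vdot (\<mu> s) b *s s" by (simp only: diff_eq_eq)
  then have "s = y *s (b - r)" using y by (simp only: vector_smult_assoc mult.commute vector_smult_lid)
  also have "\<dots> \<in> rspan ?T" unfolding r_def
    by (intro rmod.span_scale rmod.span_diff rmod.span_sum rmod.span_base) auto
  finally have s': "s \<in> rspan ?T" .
  have "t \<in> rspan ?T" if "t \<in> S" for t
    by (cases "t = s") (use s' that in \<open>auto intro: rmod.span_base\<close>)
  moreover have "t \<in> rspan S" if "t \<in> ?T" for t
    by (cases "t = b") (use b that in \<open>auto intro: rmod.span_base\<close>)
  ultimately show "rspan ?T = rspan S" by (intro rmod.span_eq[THEN iffD2] conjI subsetI)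
qed

text \<open>The axioms of the truncation \<open>min v 1\<close> of a valuation \<open>v\<close>, as a function on the ring of
  integers modulo an element of valuation \<open>1\<close>.\<close>

locale truncated_valuation =
  fixes \<nu> :: "'r::comm_ring_1 \<Rightarrow> real"
  assumes \<nu>_nonneg: "0 \<le> \<nu> x" and \<nu>_le_1: "\<nu> x \<le> 1"
    and \<nu>_0 [simp]: "\<nu> 0 = 1" and \<nu>_1 [simp]: "\<nu> 1 = 0"
    and \<nu>_add: "min (\<nu> x) (\<nu> y) \<le> \<nu> (x + y)"
    and \<nu>_mult: "\<nu> (x * y) = min (\<nu> x + \<nu> y) 1"
    and \<nu>_unit: "\<nu> x = 0 \<Longrightarrow> x dvd 1"
begin

lemma \<nu>_minus [simp]: "\<nu> (- x) = \<nu> x"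
proof -
  have "min (\<nu> (-1) + \<nu> (-1)) 1 = 0" using \<nu>_mult[of "-1" "-1"] by simp
  then have "\<nu> (-1) = 0" using \<nu>_nonneg[of "-1"] by linarith
  then show ?thesis using \<nu>_mult[of "-1" x] \<nu>_le_1[of x] by simp
qed

lemma \<nu>_sum: "t \<le> 1 \<Longrightarrow> (\<And>x. x \<in> A \<Longrightarrow> t \<le> \<nu> (g x)) \<Longrightarrow> t \<le> \<nu> (sum g A)"
proof (induction A rule: infinite_finite_induct)
  case (insert x F)
  then have "t \<le> \<nu> (g x)" "t \<le> \<nu> (sum g F)" by auto
  then show ?case using \<nu>_add[of "g x" "sum g F"] insert.hyps by simp
qed auto

lemma \<nu>_mult_ge: "t \<le> \<nu> x \<Longrightarrow> t \<le> \<nu> (c * x)"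
  using \<nu>_mult[of c x] \<nu>_nonneg[of c] \<nu>_le_1[of x] by simp

text \<open>Locality of the ring: value 0 characterises units, and a sum of nonunits is a
  nonunit.\<close>

lemma \<nu>_sum_eq_0: "\<nu> (sum g A) = 0 \<Longrightarrow> \<exists>x\<in>A. \<nu> (g x) = 0"
proof (induction A rule: infinite_finite_induct)
  case (insert x F)
  then have "min (\<nu> (g x)) (\<nu> (sum g F)) \<le> 0"
    using \<nu>_add[of "g x" "sum g F"] by simp
  then have "\<nu> (g x) = 0 \<or> \<nu> (sum g F) = 0"
    using \<nu>_nonneg[of "g x"] \<nu>_nonneg[of "sum g F"] by linarith
  then show ?case using insert.IH by blast
qed auto

text \<open>Steinitz exchange over a local ring. The functionals \<open>\<eta>\<close> need to
  separate \<open>B\<close> only residually (units on the diagonal, nonunits off it), so the lemma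
  covers perturbations of a basis as well as a basis with its dual family.\<close>

lemma exchange:
  assumes C: "finite C" "dual_on C \<mu>" and "finite B" "B \<subseteq> rspan C"
    and "\<And>b b'. b \<in> B \<Longrightarrow> b' \<in> B \<Longrightarrow> \<nu> (vdot (\<eta> b) b') = 0 \<longleftrightarrow> b = b'"
  shows "\<exists>C' \<mu>'. C' \<subseteq> C \<and> B \<inter> C' = {} \<and> dual_on (B \<union> C') \<mu>' \<and> rspan (B \<union> C') = rspan C \<and>
           card B + card C' = card C"
  using assms(3-5)
proof (induction B)
  case empty
  then show ?case using C by auto
next
  case (insert b B)
  then obtain C' \<mu>' where IH: "C' \<subseteq> C" "B \<inter> C' = {}" "dual_on (B \<union> C') \<mu>'"
    "rspan (B \<union> C') = rspan C" "card B + card C' = card C" by auto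
  have fin: "finite (B \<union> C')" "finite C'" using insert.hyps C(1) IH(1) finite_subset by auto
  have b: "b \<in> rspan (B \<union> C')" using insert.prems IH by simp
  have "(\<Sum>s\<in>B \<union> C'. vdot (\<mu>' s) b * vdot (\<eta> b) s) = vdot (\<eta> b) (\<Sum>s\<in>B \<union> C'. vdot (\<mu>' s) b *s s)"
    by (simp only: vdot_sum_right vdot_scale_right)
  also have "\<dots> = vdot (\<eta> b) b" by (simp only: dual_on_expand[OF fin(1) IH(3) b, symmetric])
  finally have "\<nu> (\<Sum>s\<in>B \<union> C'. vdot (\<mu>' s) b * vdot (\<eta> b) s) = 0"
    using insert.prems(2)[of b b] by simp
  \<comment> \<open>Some summand is a unit, hence so are both of its factors: the first makes the
    swap of \<open>s\<close> for \<open>b\<close> possible, the second shows that \<open>s\<close>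
    is not among the vectors of \<open>B\<close> inserted earlier.\<close>
  from \<nu>_sum_eq_0[OF this] obtain s where s: "s \<in> B \<union> C'" "\<nu> (vdot (\<mu>' s) b * vdot (\<eta> b) s) = 0"
    by blast
  then have z: "\<nu> (vdot (\<mu>' s) b) = 0" "\<nu> (vdot (\<eta> b) s) = 0"
    using \<nu>_nonneg[of "vdot (\<mu>' s) b"] \<nu>_nonneg[of "vdot (\<eta> b) s"]
    by (auto simp: \<nu>_mult min_def split: if_splits)
  have sB: "s \<notin> B" using z(2) insert.prems(2)[of b s] insert.hyps by auto
  obtain y where y: "vdot (\<mu>' s) b * y = 1" using \<nu>_unit[OF z(1)] by (metis dvd_def)
  have eq: "insert b (B \<union> C' - {s}) = insert b B \<union> (C' - {s})" using sB by auto
  note sw = dual_on_swap[OF fin(1) IH(3) b s(1) y, unfolded eq]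
  have "Suc (card (C' - {s})) = card C'" using fin s(1) sB by (intro card_Suc_Diff1) auto
  moreover have "card (insert b B) = Suc (card B)" using insert.hyps by simp
  ultimately have "card (insert b B) + card (C' - {s}) = card C" using IH(5) by linarith
  moreover have "insert b B \<inter> (C' - {s}) = {}" using sw(1) IH(2) by auto
  moreover obtain \<mu>'' where "dual_on (insert b B \<union> (C' - {s})) \<mu>''" using sw(2) by (elim exE)
  ultimately show ?case using sw(3) IH(1,4)
    by (intro exI[of _ "C' - {s}"] exI[of _ \<mu>'']) auto
qed

lemma exchange_dual:
  fixes B C :: "('r ^ 'n) set"
  assumes "finite C" "dual_on C \<mu>" "finite B" "B \<subseteq> rspan C" "dual_on B \<eta>"
  shows "\<exists>C' \<mu>'. C' \<subseteq> C \<and> B \<inter> C' = {} \<and> dual_on (B \<union> C') \<mu>' \<and> rspan (B \<union> C') = rspan C \<and>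
           card B + card C' = card C"
  by (rule exchange[of C \<mu> B \<eta>]) (use assms in \<open>auto simp: dual_on_def\<close>)

text \<open>A basis of \<open>N\<close> extends to a basis of \<open>M\<close> by part of a given
  basis of \<open>M\<close>; the added vectors form the basis of M/N.\<close>

lemma split_module_quotient:
  fixes M N :: "('r ^ 'n) set"
  assumes M: "split_module M m" and N: "split_module N n" and "N \<subseteq> M"
  shows "n \<le> m" and "\<exists>u. quotient_basis M N (m - n) u"
proof -
  obtain C \<mu> where C: "finite C" "card C = m" "dual_on C \<mu>" "rspan C = M"
    using M unfolding split_module_def by blast
  obtain B \<eta> where B: "finite B" "card B = n" "dual_on B \<eta>" "rspan B = N"
    using N unfolding split_module_def by blast
  have "B \<subseteq> rspan C" using rmod.span_superset[of B] B(4) C(4) assms(3) by simp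
  then obtain C' \<mu>' where C': "C' \<subseteq> C" "B \<inter> C' = {}" "dual_on (B \<union> C') \<mu>'" "rspan (B \<union> C') = M"
    "n + card C' = m"
    using exchange_dual[OF C(1,3) B(1) _ B(3)] B C by auto
  then show "n \<le> m" by simp
  have fin: "finite C'" "finite (B \<union> C')" using C' C B finite_subset by auto
  obtain u where u: "bij_betw u {..<m - n} C'"
    using ex_bij_betw_nat_finite[OF fin(1)] C'(5) by (auto simp: atLeast0LessThan)
  have ureidx: "(\<Sum>a<m-n. g (u a)) = (\<Sum>s\<in>C'. g s)" for g :: "_ \<Rightarrow> 'r ^ 'n"
    by (rule sum.reindex_bij_betw[OF u])
  have "quotient_basis M N (m - n) u"
  proof (rule quotient_basisI)
    show "submodule N" using rmod.subspace_span[of B] B(4) by simp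
    show "u a \<in> M" if "a < m - n" for a
      using bij_betwE[OF u] that C'(4) rmod.span_base[of "u a" "B \<union> C'"] by auto
  next
    fix x assume "x \<in> M"
    then have "x = (\<Sum>s\<in>B \<union> C'. vdot (\<mu>' s) x *s s)"
      by (intro dual_on_expand[OF fin(2) C'(3)]) (simp add: C'(4))
    also have "\<dots> = (\<Sum>s\<in>B. vdot (\<mu>' s) x *s s) + (\<Sum>s\<in>C'. vdot (\<mu>' s) x *s s)"
      using fin B(1) C'(2) by (intro sum.union_disjoint)
    also have "(\<Sum>s\<in>C'. vdot (\<mu>' s) x *s s) = (\<Sum>a<m-n. vdot (\<mu>' (u a)) x *s u a)"
      by (simp only: ureidx[of "\<lambda>s. vdot (\<mu>' s) x *s s"])
    finally have "x - (\<Sum>a<m-n. vdot (\<mu>' (u a)) x *s u a) = (\<Sum>s\<in>B. vdot (\<mu>' s) x *s s)"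
      by (simp add: algebra_simps)
    also have "\<dots> \<in> N" unfolding B(4)[symmetric]
      by (intro rmod.span_sum rmod.span_scale rmod.span_base)
    finally show "\<exists>c. x - (\<Sum>a<m-n. c a *s u a) \<in> N" by (rule exI[of _ "\<lambda>a. vdot (\<mu>' (u a)) x"])
  next
    fix c a assume in_N: "(\<Sum>a<m-n. c a *s u a) \<in> N" and a: "a < m - n"
    have ua: "u a \<in> C'" using bij_betwE[OF u] a by auto
    \<comment> \<open>The functional dual to an added vector kills \<open>B\<close>, hence all of
      \<open>N\<close>, and so reads off coefficients modulo \<open>N\<close>.\<close>
    have "vdot (\<mu>' (u a)) x = 0" if "x \<in> N" for x
    proof -
      have "x = (\<Sum>s\<in>B. vdot (\<eta> s) x *s s)" using that B(4) by (intro dual_on_expand[OF B(1,3)]) simp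
      moreover have "vdot (\<mu>' (u a)) s = 0" if "s \<in> B" for s
        using C'(2,3) ua that unfolding dual_on_def by auto
      then have "vdot (\<mu>' (u a)) (\<Sum>s\<in>B. vdot (\<eta> s) x *s s) = 0"
        unfolding vdot_sum_right vdot_scale_right by (intro sum.neutral) simp
      ultimately show ?thesis by (rule ssubst)
    qed
    then have "0 = vdot (\<mu>' (u a)) (\<Sum>a<m-n. c a *s u a)" using in_N by simp
    also have "\<dots> = (\<Sum>b<m-n. if b = a then c b else 0)"
      unfolding vdot_sum_right vdot_scale_right
    proof (rule sum.cong)
      fix b assume b: "b \<in> {..<m-n}"
      then have "u b \<in> C'" using bij_betwE[OF u] by auto
      moreover have "u a = u b \<longleftrightarrow> a = b" using u a b by (auto simp: bij_betw_def inj_on_def)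
      ultimately show "c b * vdot (\<mu>' (u a)) (u b) = (if b = a then c b else 0)"
        using C'(3) ua unfolding dual_on_def by auto
    qed simp
    also have "\<dots> = c a" using a by simp
    finally show "c a = 0" by simp
  qed
  then show "\<exists>u. quotient_basis M N (m - n) u" by blast
qed

lemma split_module_0: "split_module {0} 0"
  unfolding split_module_def by (intro exI[of _ "{}"]) (simp add: dual_on_def)

definition small :: "real \<Rightarrow> ('r ^ 'n) set" where
  "small t = {x. \<forall>a. t \<le> \<nu> (vec_nth x a)}"

lemma submodule_small: "t \<le> 1 \<Longrightarrow> submodule (small t)"
proof (rule rmod.subspaceI)
  show "x + y \<in> small t" if "x \<in> small t" "y \<in> small t" for x y :: "'r ^ 'n"
    using that unfolding small_def by (auto intro!: order_trans[OF _ \<nu>_add])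
qed (auto simp: small_def intro!: \<nu>_mult_ge)

lemma small_vdot: "t \<le> 1 \<Longrightarrow> x \<in> small t \<Longrightarrow> t \<le> \<nu> (vdot y x)"
  unfolding vdot_def small_def by (intro \<nu>_sum \<nu>_mult_ge) auto

lemma small_matrix: "t \<le> 1 \<Longrightarrow> x \<in> small t \<Longrightarrow> A *v x \<in> small t"
  unfolding small_def matrix_vector_mult_def by (auto intro!: \<nu>_sum \<nu>_mult_ge)

lemma small_scale: "t \<le> \<nu> c \<Longrightarrow> c *s x \<in> small t"
  unfolding small_def by (simp add: \<nu>_mult_ge mult.commute[of c])

text \<open>One-sided: \<open>N\<close> is contained in \<open>N'\<close> up to
  \<open>small t\<close>.\<close>

definition close :: "real \<Rightarrow> ('r ^ 'n) set \<Rightarrow> ('r ^ 'n) set \<Rightarrow> bool" where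
  "close t N N' \<longleftrightarrow> (\<forall>x\<in>N. \<exists>y\<in>N'. x - y \<in> small t)"

text \<open>A basis of \<open>N'\<close> is close to a family in \<open>N\<close>; this family is residually independent, hence a
  basis of \<open>N\<close> by the exchange lemma.\<close>

lemma close_sym:
  assumes N: "split_module N k" and N': "split_module N' k" and t: "0 < t" "t \<le> 1"
    and "close t N' N"
  shows "close t N N'"
proof -
  obtain C \<mu> where C: "finite C" "card C = k" "dual_on C \<mu>" "rspan C = N"
    using N unfolding split_module_def by blast
  obtain B \<eta> where B: "finite B" "card B = k" "dual_on B \<eta>" "rspan B = N'"
    using N' unfolding split_module_def by blast
  have "B \<subseteq> N'" using rmod.span_superset[of B] B(4) by simp
  then have "\<forall>b\<in>B. \<exists>y. y \<in> N \<and> b - y \<in> small t"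
    using assms(5) unfolding close_def by blast
  from bchoice[OF this] obtain g where g: "\<And>b. b \<in> B \<Longrightarrow> g b \<in> N" "\<And>b. b \<in> B \<Longrightarrow> b - g b \<in> small t"
    by blast
  \<comment> \<open>Moving b' to g b' changes the pairing by an element of value at least t > 0,
    that is, by a nonunit; the duality relations survive residually.\<close>
  have unit: "\<nu> (vdot (\<eta> b) (g b')) = 0 \<longleftrightarrow> b = b'" if "b \<in> B" "b' \<in> B" for b b'
  proof -
    have e: "t \<le> \<nu> (vdot (\<eta> b) (b' - g b'))" by (intro small_vdot t g that)
    have d: "vdot (\<eta> b) b' = (if b = b' then 1 else 0)" using B(3) that unfolding dual_on_def by blast
    show ?thesis
    proof (cases "b = b'")
      case True
      have "\<nu> (vdot (\<eta> b) (g b') + vdot (\<eta> b) (b' - g b')) = 0"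
        using d True by (simp add: vdot_diff_right)
      then show ?thesis
        using \<nu>_add[of "vdot (\<eta> b) (g b')" "vdot (\<eta> b) (b' - g b')"] e t \<nu>_nonneg[of "vdot (\<eta> b) (g b')"] True
        by linarith
    next
      case False
      then have "vdot (\<eta> b) (g b') = - vdot (\<eta> b) (b' - g b')" using d by (simp add: vdot_diff_right)
      then show ?thesis using e t False by simp
    qed
  qed
  have inj: "inj_on g B"
    by (rule inj_onI) (metis unit)
  define \<eta>' where "\<eta>' = \<eta> \<circ> inv_into B g"
  have "\<nu> (vdot (\<eta>' b) b') = 0 \<longleftrightarrow> b = b'" if "b \<in> g ` B" "b' \<in> g ` B" for b b'
    using that by (auto simp: \<eta>'_def inj unit)
  moreover have "g ` B \<subseteq> rspan C" using g(1) C(4) by auto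
  ultimately obtain C' \<mu>' where "rspan (g ` B \<union> C') = N" "card (g ` B) + card C' = k" "C' \<subseteq> C"
    using exchange[OF C(1,3), of "g ` B" \<eta>'] B(1) C(2,4) by auto
  moreover have "card (g ` B) = k" using inj B(2) by (simp add: card_image)
  moreover have "finite C'" using \<open>C' \<subseteq> C\<close> C(1) by (rule finite_subset)
  \<comment> \<open>Equality of ranks leaves no room for the complement: \<open>C'\<close> has
    cardinality 0.\<close>
  ultimately have span: "rspan (g ` B) = N" by simp
  show ?thesis unfolding close_def
  proof
    fix x assume "x \<in> N"
    then obtain c where "x = (\<Sum>s\<in>g ` B. c s *s s)"
      unfolding span[symmetric] rmod.span_finite[OF finite_imageI[OF B(1)]] by (elim imageE)
    then have x: "x = (\<Sum>b\<in>B. c (g b) *s g b)" by (simp add: sum.reindex[OF inj])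
    let ?y = "\<Sum>b\<in>B. c (g b) *s b"
    have "x - ?y = (\<Sum>b\<in>B. (- c (g b)) *s (b - g b))"
      by (simp add: x sum_subtractf[symmetric] vector_ssub_ldistrib)
    also have "\<dots> \<in> small t"
      by (intro rmod.subspace_sum rmod.subspace_scale submodule_small t g)
    finally have "x - ?y \<in> small t" .
    moreover have "?y \<in> N'" unfolding B(4)[symmetric]
      by (intro rmod.span_sum rmod.span_scale rmod.span_base)
    ultimately show "\<exists>y\<in>N'. x - y \<in> small t" by blast
  qed
qed

end

text \<open>The functional dual to a basis vector \<open>b\<close> sends x to the
  \<open>b\<close>-coordinate of A x; its entries are the values on the standard basis of
  R^n.\<close>

lemma split_module_of_projection:
  assumes N: "free_of_rank N k" and A: "\<And>x. A *v x \<in> N" "\<And>x. x \<in> N \<Longrightarrow> A *v x = x"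
  shows "split_module N k"
proof -
  obtain B where B: "finite B" "card B = k" "rmod.independent B" "rspan B = N"
    using N unfolding free_of_rank_def by blast
  define \<mu> where "\<mu> b = (\<chi> k. rmod.representation B (A *v axis k 1) b)" for b
  have "vdot (\<mu> b) c = (if b = c then 1 else 0)" if "b \<in> B" "c \<in> B" for b c
  proof -
    have ax: "A *v axis k 1 \<in> rspan B" for k using A(1) B(4) by simp
    have "c \<in> N" using rmod.span_base[OF that(2)] B(4) by simp
    then have "c = A *v (\<Sum>k\<in>UNIV. vec_nth c k *s axis k 1)"
      using A(2) vec_axis_expand[of c] by simp
    then have c: "c = (\<Sum>k\<in>UNIV. vec_nth c k *s (A *v axis k 1))"
      by (simp only: matrix_vector_sum matrix_vector_scale)
    have "rmod.representation B (\<Sum>k\<in>UNIV. vec_nth c k *s (A *v axis k 1)) b =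
      (\<Sum>k\<in>UNIV. vec_nth c k * rmod.representation B (A *v axis k 1) b)"
      using rmod.representation_sum[OF B(3), of UNIV "\<lambda>k. vec_nth c k *s (A *v axis k 1)"]
        rmod.representation_scale[OF B(3) ax] ax by (simp add: rmod.span_scale)
    also have "\<dots> = vdot (\<mu> b) c"
      unfolding vdot_def \<mu>_def by (simp add: mult.commute)
    finally have "rmod.representation B c b = vdot (\<mu> b) c" by (simp only: c[symmetric])
    then show ?thesis by (simp add: rmod.representation_basis[OF B(3) that(2)])
  qed
  then show ?thesis unfolding split_module_def dual_on_def using B by blast
qed

text \<open>The projection of \<open>M\<close> onto \<open>N\<close> along a complement is composed
  with the retraction \<open>P\<close> of R^n onto \<open>M\<close>. The value selected by
  \<open>SOME\<close> is the only possible one, and this makes the composite linear.\<close>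

lemma direct_factor_projection:
  assumes N: "direct_factor M N k" and M: "\<And>x. P *v x \<in> M" "\<And>x. x \<in> M \<Longrightarrow> P *v x = x"
  obtains A where "\<And>x. A *v x \<in> N" "\<And>x. x \<in> N \<Longrightarrow> A *v x = x"
proof -
  obtain C where C: "submodule C" "N \<inter> C = {0}" "M = {x + y |x y. x \<in> N \<and> y \<in> C}"
    using N unfolding direct_factor_def by blast
  obtain B where "rspan B = N" using N unfolding direct_factor_def free_of_rank_def by blast
  then have sN: "submodule N" using rmod.subspace_span[of B] by simp
  have NM: "x \<in> M" if "x \<in> N" for x
    using that rmod.subspace_0[OF C(1)] C(3) by force
  define g where "g x = (SOME y. y \<in> N \<and> P *v x - y \<in> C)" for x
  have g: "g x \<in> N" "P *v x - g x \<in> C" for x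
  proof -
    obtain y z where "y \<in> N" "z \<in> C" "P *v x = y + z" using M(1)[of x] C(3) by auto
    then have "y \<in> N \<and> P *v x - y \<in> C" by simp
    then have "g x \<in> N \<and> P *v x - g x \<in> C" unfolding g_def by (rule someI)
    then show "g x \<in> N" "P *v x - g x \<in> C" by auto
  qed
  have g_eq: "g x = y" if "y \<in> N" "P *v x - y \<in> C" for x y
  proof -
    have "(P *v x - y) - (P *v x - g x) \<in> C" by (intro rmod.subspace_diff C that g)
    then have "g x - y \<in> C" by simp
    moreover have "g x - y \<in> N" by (intro rmod.subspace_diff sN that g)
    ultimately have "g x - y \<in> N \<inter> C" by blast
    then show ?thesis using C(2) by simp
  qed
  have "module_hom (*s) (*s) g"
  proof unfold_locales
    fix x y :: "'a ^ 'b" and c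
    have "(P *v x - g x) + (P *v y - g y) \<in> C" by (intro rmod.subspace_add C g)
    then show "g (x + y) = g x + g y"
      by (intro g_eq rmod.subspace_add sN g) (simp add: matrix_vector_add algebra_simps)
    have "c *s (P *v x - g x) \<in> C" by (intro rmod.subspace_scale C g)
    then show "g (c *s x) = c *s g x"
      by (intro g_eq rmod.subspace_scale sN g) (simp add: matrix_vector_scale vector_ssub_ldistrib)
  qed
  then obtain A where A: "\<And>x. A *v x = g x" by (rule matrix_of_linear) blast
  show ?thesis
  proof (rule that)
    show "A *v x \<in> N" for x using A g(1) by simp
    show "A *v x = x" if "x \<in> N" for x
      using that rmod.subspace_0[OF C(1)] by (simp add: A g_eq M(2) NM)
  qed
qed

lemma sum_matrix_vector: "(\<Sum>i\<in>I. A i) *v (x :: 'r::comm_ring_1 ^ 'n) = (\<Sum>i\<in>I. A i *v x)"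
  by (induction I rule: infinite_finite_induct) (simp_all add: matrix_vector_mult_add_rdistrib)

section \<open>Frobenius twists\<close>

locale frobenius_valuation = truncated_valuation \<nu> for \<nu> :: "'r::comm_ring_1 \<Rightarrow> real" +
  fixes p :: nat
  assumes p_pos: "0 < p" and frobenius_add: "((x :: 'r) + y) ^ p = x ^ p + y ^ p"
begin

lemma zero_power_p [simp]: "(0 :: 'r) ^ p = 0"
  using p_pos by (rule zero_power)

lemma frobenius_sum: "(\<Sum>i\<in>I. g i :: 'r) ^ p = (\<Sum>i\<in>I. g i ^ p)"
  by (induction I rule: infinite_finite_induct) (simp_all add: frobenius_add p_pos)

lemma frob_vec_add: "frob_vec p (x + y :: 'r ^ 'n) = frob_vec p x + frob_vec p y"
  and frob_vec_scale: "frob_vec p (c *s x :: 'r ^ 'n) = c ^ p *s frob_vec p x"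
  and frob_vec_0: "frob_vec p (0 :: 'r ^ 'n) = 0"
  by (simp_all add: frob_vec_def Finite_Cartesian_Product.vec_eq_iff frobenius_add power_mult_distrib p_pos)

lemma frob_vec_diff: "frob_vec p (x - y :: 'r ^ 'n) = frob_vec p x - frob_vec p y"
  using frob_vec_add[of "x - y" y] by (simp add: eq_diff_eq)

lemma frob_vec_axis: "frob_vec p (axis k 1 :: 'r ^ 'n) = axis k 1"
  by (simp add: frob_vec_def Finite_Cartesian_Product.vec_eq_iff axis_def p_pos)

lemma frob_vec_mult: "frob_vec p (A *v x) = frob_mat p A *v frob_vec p (x :: 'r ^ 'n)"
  by (simp add: frob_vec_def frob_mat_def Finite_Cartesian_Product.vec_eq_iff matrix_vector_mult_def
      frobenius_sum power_mult_distrib)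

lemma frob_mat_mult: "frob_mat p (A ** B) = frob_mat p A ** frob_mat p (B :: 'r ^ 'n ^ 'm)"
  by (simp add: frob_mat_def Finite_Cartesian_Product.vec_eq_iff matrix_matrix_mult_def
      frobenius_sum power_mult_distrib)

lemma frob_mat_sum: "frob_mat p (\<Sum>i\<in>I. A i) = (\<Sum>i\<in>I. frob_mat p (A i :: 'r ^ 'n ^ 'm))"
  by (simp add: frob_mat_def Finite_Cartesian_Product.vec_eq_iff frobenius_sum)

lemma frob_mat_1: "frob_mat p (Finite_Cartesian_Product.mat 1 :: 'r ^ 'n ^ 'n) = Finite_Cartesian_Product.mat 1"
  by (simp add: frob_mat_def Finite_Cartesian_Product.vec_eq_iff Finite_Cartesian_Product.mat_def p_pos)

lemma submodule_twist: "submodule (twist p N)"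
  unfolding twist_def by simp

lemma frob_vec_twist: "x \<in> N \<Longrightarrow> frob_vec p x \<in> twist p N"
  unfolding twist_def by (intro rmod.span_base imageI)

lemma twist_subset: "submodule T \<Longrightarrow> (\<And>x. x \<in> N \<Longrightarrow> frob_vec p x \<in> T) \<Longrightarrow> twist p N \<subseteq> T"
  unfolding twist_def by (intro rmod.span_minimal) auto

lemma twist_mono: "N \<subseteq> N' \<Longrightarrow> twist p N \<subseteq> twist p (N' :: ('r ^ 'n) set)"
  unfolding twist_def by (intro rmod.span_mono image_mono)

lemma twist_image: "twist p ((*v) A ` N) = (*v) (frob_mat p A) ` twist p (N :: ('r ^ 'n) set)"
  unfolding twist_def span_matrix_image[symmetric] image_image frob_vec_mult ..

text \<open>\<open>frob_vec\<close> is additive and multiplies scalars through their p-th powers, so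
  generators of a module yield generators of its twist.\<close>

lemma twist_span: "twist p (rspan S) = rspan (frob_vec p ` (S :: ('r ^ 'n) set))"
proof
  show "rspan (frob_vec p ` S) \<subseteq> twist p (rspan S)"
    by (intro rmod.span_minimal submodule_twist) (auto intro: frob_vec_twist rmod.span_base)
  have "frob_vec p x \<in> rspan (frob_vec p ` S)" if "x \<in> rspan S" for x
    using that
  proof (induction rule: rmod.span_induct_alt)
    case base then show ?case by (simp add: frob_vec_0 rmod.span_zero)
  next
    case (step c x y)
    then show ?case
      by (auto simp: frob_vec_add frob_vec_scale intro!: rmod.span_add rmod.span_scale intro: rmod.span_base)
  qed
  then show "twist p (rspan S) \<subseteq> rspan (frob_vec p ` S)"
    by (intro twist_subset) auto
qed

lemma twist_UNIV: "twist p (UNIV :: ('r ^ 'n) set) = UNIV"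
proof -
  have "x \<in> twist p UNIV" for x :: "'r ^ 'n"
    by (subst vec_axis_expand, intro rmod.subspace_sum rmod.subspace_scale submodule_twist)
      (metis frob_vec_axis frob_vec_twist UNIV_I)
  then show ?thesis by blast
qed

text \<open>The pairing of twisted vectors is the p-th power of the pairing, and 0 and 1 are fixed
  by this power: a dual family twists to a dual family.\<close>

lemma split_module_twist:
  assumes "split_module (N :: ('r ^ 'n) set) k"
  shows "split_module (twist p N) k"
proof -
  obtain S \<mu> where S: "finite S" "card S = k" "dual_on S \<mu>" "rspan S = N"
    using assms unfolding split_module_def by blast
  have vdot: "vdot (frob_vec p x) (frob_vec p y) = vdot x y ^ p" for x y :: "'r ^ 'n"
    by (simp add: vdot_def frob_vec_def frobenius_sum power_mult_distrib)
  have d: "vdot (frob_vec p (\<mu> b)) (frob_vec p c) = (if b = c then 1 else 0)" if "b \<in> S" "c \<in> S" for b c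
    using S(3) that p_pos unfolding vdot dual_on_def by simp
  have inj: "inj_on (frob_vec p) S"
    by (rule inj_onI) (metis d one_neq_zero)
  have "dual_on (frob_vec p ` S) (frob_vec p \<circ> \<mu> \<circ> inv_into S (frob_vec p))"
    using inj by (auto simp: dual_on_def d inj_on_eq_iff)
  moreover have "card (frob_vec p ` S) = k" using inj S(2) by (simp add: card_image)
  ultimately show ?thesis unfolding split_module_def
    using S(1,4) twist_span[of S] by (metis finite_imageI)
qed

lemma small_frob_vec: "x \<in> small t \<Longrightarrow> frob_vec p x \<in> small t"
proof -
  have "t \<le> \<nu> c \<Longrightarrow> t \<le> \<nu> (c ^ p)" for c
    using \<nu>_mult_ge[of t c "c ^ (p - 1)"] by (simp only: power_minus_mult[OF p_pos])
  then show "x \<in> small t \<Longrightarrow> frob_vec p x \<in> small t" by (simp add: small_def frob_vec_def)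
qed

text \<open>The vectors lying within precision t of \<open>twist p N'\<close> form a submodule, so
  only the generators of \<open>twist p N\<close> have to be tested.\<close>

lemma close_twist:
  assumes "t \<le> 1" "close t N (N' :: ('r ^ 'n) set)"
  shows "close t (twist p N) (twist p N')"
proof -
  let ?T = "{x. \<exists>y\<in>twist p N'. x - y \<in> small t}"
  have "submodule ?T"
  proof (rule rmod.subspaceI; clarify)
    show "\<exists>y\<in>twist p N'. 0 - y \<in> small t"
      using rmod.subspace_0[OF submodule_twist] rmod.subspace_0[OF submodule_small[OF assms(1)]]
      by (intro bexI[of _ 0]) auto
  next
    fix x y x' y' assume *: "x' \<in> twist p N'" "y' \<in> twist p N'" "x - x' \<in> small t" "y - y' \<in> small t"
    have "(x - x') + (y - y') \<in> small t" by (intro rmod.subspace_add submodule_small assms *)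
    then show "\<exists>z\<in>twist p N'. x + y - z \<in> small t"
      by (intro bexI[of _ "x' + y'"] rmod.subspace_add submodule_twist *) (simp add: algebra_simps)
  next
    fix c x x' assume *: "x' \<in> twist p N'" "x - x' \<in> small t"
    have "c *s (x - x') \<in> small t" by (intro rmod.subspace_scale submodule_small assms *)
    then show "\<exists>z\<in>twist p N'. c *s x - z \<in> small t"
      by (intro bexI[of _ "c *s x'"] rmod.subspace_scale submodule_twist *) (simp add: vector_ssub_ldistrib)
  qed
  moreover have "frob_vec p x \<in> ?T" if x: "x \<in> N" for x
  proof -
    obtain y where "y \<in> N'" "x - y \<in> small t" using assms(2) x unfolding close_def by blast
    then show ?thesis using small_frob_vec[of "x - y" t] frob_vec_twist[of y N'] by (auto simp: frob_vec_diff)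
  qed
  ultimately have "twist p N \<subseteq> ?T" by (rule twist_subset)
  then show ?thesis unfolding close_def by blast
qed

end

section \<open>Determinants of natural maps\<close>

text \<open>The adjugate identities as index sums, since quotient bases are indexed by naturals and
  not by a matrix type.\<close>

lemma adjugate:
  assumes "A \<in> carrier_mat n n"
  obtains B where
    "\<forall>a<n. \<forall>b<n. (\<Sum>k<n. A $$ (a, k) * B k b) = (if a = b then Determinant.det A else 0)"
    "\<forall>a<n. \<forall>b<n. (\<Sum>k<n. B a k * A $$ (k, b)) = (if a = b then Determinant.det A else 0)"
proof (rule that[of "\<lambda>a b. adj_mat A $$ (a, b)"]; intro allI impI)
  note adj = adj_mat[OF assms]
  fix a b assume ab: "a < n" "b < n"
  have "(\<Sum>k<n. A $$ (a, k) * adj_mat A $$ (k, b)) = (A * adj_mat A) $$ (a, b)"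
    using ab assms adj(1) by (simp add: scalar_prod_def atLeast0LessThan)
  then show "(\<Sum>k<n. A $$ (a, k) * adj_mat A $$ (k, b)) = (if a = b then Determinant.det A else 0)"
    using ab by (simp add: adj(2))
  have "(\<Sum>k<n. adj_mat A $$ (a, k) * A $$ (k, b)) = (adj_mat A * A) $$ (a, b)"
    using ab assms adj(1) by (simp add: scalar_prod_def atLeast0LessThan)
  then show "(\<Sum>k<n. adj_mat A $$ (a, k) * A $$ (k, b)) = (if a = b then Determinant.det A else 0)"
    using ab by (simp add: adj(3))
qed

text \<open>The existence of one pair of bases makes the \<open>SOME\<close> in
  \<open>natural_det\<close> effective. The bases obtained are those behind the chosen determinant
  and may differ from the given ones.\<close>

lemma natural_det_cases:
  assumes u0: "quotient_basis M N n u0" and u0': "quotient_basis M' N' n u0'" and "M \<subseteq> M'"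
  obtains u u' A where "quotient_basis M N n u" "quotient_basis M' N' n u'"
    "A \<in> carrier_mat n n" "\<forall>b<n. u b - (\<Sum>a<n. A $$ (a, b) *s u' a) \<in> N'"
    "natural_det M N M' N' n = Determinant.det A"
proof -
  have "\<forall>b\<in>{..<n}. \<exists>c. u0 b - (\<Sum>a<n. c a *s u0' a) \<in> N'"
  proof
    fix b assume "b \<in> {..<n}"
    then have "u0 b \<in> M'" using quotient_basis_mem[OF u0] assms(3) by auto
    then obtain c where "u0 b - (\<Sum>a<n. c a *s u0' a) \<in> N'" by (rule quotient_basis_coords[OF u0'])
    then show "\<exists>c. u0 b - (\<Sum>a<n. c a *s u0' a) \<in> N'" by (rule exI[of _ c])
  qed
  from bchoice[OF this] obtain c where "\<forall>b\<in>{..<n}. u0 b - (\<Sum>a<n. c b a *s u0' a) \<in> N'"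
    by (elim exE)
  then have c: "u0 b - (\<Sum>a<n. c b a *s u0' a) \<in> N'" if "b < n" for b using that by simp
  let ?P = "\<lambda>D. \<exists>u u' A. quotient_basis M N n u \<and> quotient_basis M' N' n u' \<and>
        A \<in> carrier_mat n n \<and> (\<forall>b<n. u b - (\<Sum>a<n. A $$ (a, b) *s u' a) \<in> N') \<and> D = Determinant.det A"
  let ?A = "Matrix.mat n n (\<lambda>(a, b). c b a)"
  have "\<forall>b<n. u0 b - (\<Sum>a<n. ?A $$ (a, b) *s u0' a) \<in> N'" using c by simp
  then have "?P (Determinant.det ?A)" using u0 u0' by (intro exI[of _ u0] exI[of _ u0'] exI[of _ ?A] conjI) simp_all
  then have "?P (natural_det M N M' N' n)" unfolding natural_det_def by (rule someI)
  then show ?thesis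
    by (elim exE conjE) (rule that)
qed

lemma sum_change_basis:
  assumes "submodule N'" "\<forall>b<n. u b - (\<Sum>a<n. A $$ (a, b) *s u' a) \<in> N'"
  shows "(\<Sum>b<n. c b *s u b) - (\<Sum>a<n. (\<Sum>b<n. A $$ (a, b) * c b) *s u' a) \<in> N'"
proof -
  have "(\<Sum>a<n. (\<Sum>b<n. A $$ (a, b) * c b) *s u' a) = (\<Sum>a<n. \<Sum>b<n. c b *s (A $$ (a, b) *s u' a))"
    by (simp add: rmod.scale_sum_left vector_smult_assoc mult.commute)
  also have "\<dots> = (\<Sum>b<n. c b *s (\<Sum>a<n. A $$ (a, b) *s u' a))"
    by (subst sum.swap) (simp add: rmod.scale_sum_right)
  finally have "(\<Sum>b<n. c b *s u b) - (\<Sum>a<n. (\<Sum>b<n. A $$ (a, b) * c b) *s u' a)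
    = (\<Sum>b<n. c b *s (u b - (\<Sum>a<n. A $$ (a, b) *s u' a)))"
    by (simp add: vector_ssub_ldistrib sum_subtractf)
  also have "\<dots> \<in> N'" by (intro rmod.subspace_sum rmod.subspace_scale assms(1)) (use assms(2) in auto)
  finally show ?thesis .
qed

context truncated_valuation
begin

text \<open>In a dual basis of \<open>M\<close> the coordinates of \<open>z\<close> are values of
  functionals on a small vector, hence small; the coordinates modulo \<open>N\<close> are linear
  combinations of these.\<close>

lemma small_coords:
  assumes M: "split_module M k" and N: "submodule N" and u: "quotient_basis M N n u"
    and z: "z \<in> M" "z \<in> small t" and t: "t \<le> 1" and c: "z - (\<Sum>a<n. c a *s u a) \<in> N" and a: "a < n"
  shows "t \<le> \<nu> (c a)"
proof -
  obtain S \<mu> where S: "finite S" "card S = k" "dual_on S \<mu>" "rspan S = M"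
    using M unfolding split_module_def by blast
  have sM: "submodule M" using M by (rule split_module_submodule)
  have "\<forall>s\<in>S. \<exists>e. s - (\<Sum>a<n. e a *s u a) \<in> N"
  proof
    fix s assume "s \<in> S"
    then have "s \<in> M" using rmod.span_base S(4) by auto
    then obtain e where "s - (\<Sum>a<n. e a *s u a) \<in> N" by (rule quotient_basis_coords[OF u])
    then show "\<exists>e. s - (\<Sum>a<n. e a *s u a) \<in> N" by (rule exI[of _ e])
  qed
  from bchoice[OF this] obtain e where "\<forall>s\<in>S. s - (\<Sum>a<n. e s a *s u a) \<in> N" by (elim exE)
  then have e: "s - (\<Sum>a<n. e s a *s u a) \<in> N" if "s \<in> S" for s using that by (rule bspec)
  define r where "r s = vdot (\<mu> s) z" for s
  have zr: "z = (\<Sum>s\<in>S. r s *s s)" unfolding r_def using z(1) S by (intro dual_on_expand) auto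
  have "(\<Sum>a<n. (\<Sum>s\<in>S. r s * e s a) *s u a) = (\<Sum>s\<in>S. \<Sum>a<n. (r s * e s a) *s u a)"
    unfolding rmod.scale_sum_left by (rule sum.swap)
  also have "\<dots> = (\<Sum>s\<in>S. r s *s (\<Sum>a<n. e s a *s u a))"
    by (simp add: rmod.scale_sum_right vector_smult_assoc)
  finally have "z - (\<Sum>a<n. (\<Sum>s\<in>S. r s * e s a) *s u a) = (\<Sum>s\<in>S. r s *s (s - (\<Sum>a<n. e s a *s u a)))"
    unfolding vector_ssub_ldistrib sum_subtractf zr[symmetric] by (rule arg_cong)
  also have "\<dots> \<in> N" by (intro rmod.subspace_sum rmod.subspace_scale N e)
  finally have "z - (\<Sum>a<n. (\<Sum>s\<in>S. r s * e s a) *s u a) \<in> N" .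
  note rmod.subspace_diff[OF N this c]
  also have "(z - (\<Sum>a<n. (\<Sum>s\<in>S. r s * e s a) *s u a)) - (z - (\<Sum>a<n. c a *s u a)) =
      (\<Sum>a<n. (c a - (\<Sum>s\<in>S. r s * e s a)) *s u a)"
    by (simp add: vector_sub_rdistrib sum_subtractf)
  finally have "c a - (\<Sum>s\<in>S. r s * e s a) = 0"
    by (rule quotient_basis_indep[OF u sM N _ a])
  then have "c a = (\<Sum>s\<in>S. e s a * r s)" by (simp add: mult.commute)
  moreover have "t \<le> \<nu> (\<Sum>s\<in>S. e s a * r s)"
    unfolding r_def by (intro \<nu>_sum \<nu>_mult_ge small_vdot t z)
  ultimately show ?thesis by simp
qed

text \<open>If \<open>c\<close> are the coordinates of x in M/N, then A c are those of its image in
  M'/N', which are small because x is close to N'. The adjugate then makes D c small. It is applied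
  with \<open>N\<close> = \<open>Fil i j\<close>, \<open>N'\<close> = \<open>tilde Fil i j\<close>
  and \<open>L\<close> = \<open>Fil' i j\<close>.\<close>

lemma natural_det_close_subset:
  assumes sub: "submodule N'" and split: "split_module M' k"
    and incl: "M \<subseteq> M'" "N \<subseteq> N'" "N' \<subseteq> M'" "L \<subseteq> M"
    and qb: "quotient_basis M N n u0" "quotient_basis M' N' n u0'"
    and t: "t \<le> 1" and L: "close t L N'"
  shows "close (t - \<nu> (natural_det M N M' N' n)) L N"
  unfolding close_def
proof
  obtain u u' A where u: "quotient_basis M N n u" and u': "quotient_basis M' N' n u'"
    and A: "A \<in> carrier_mat n n" and uA: "\<forall>b<n. u b - (\<Sum>a<n. A $$ (a, b) *s u' a) \<in> N'"
    and D: "natural_det M N M' N' n = Determinant.det A"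
    by (rule natural_det_cases[OF qb incl(1)])
  obtain B where "\<forall>a<n. \<forall>b<n. (\<Sum>k<n. A $$ (a, k) * B k b) = (if a = b then Determinant.det A else 0)"
    and B: "\<forall>a<n. \<forall>b<n. (\<Sum>k<n. B a k * A $$ (k, b)) = (if a = b then Determinant.det A else 0)"
    by (rule adjugate[OF A])
  have sM': "submodule M'" using split by (rule split_module_submodule)
  fix x assume x: "x \<in> L"
  then obtain y where y: "y \<in> N'" "x - y \<in> small t" using L unfolding close_def by blast
  have "x \<in> M" using x incl by blast
  then obtain c where c: "x - (\<Sum>b<n. c b *s u b) \<in> N" by (rule quotient_basis_coords[OF u])
  define e where "e a = (\<Sum>b<n. A $$ (a, b) * c b)" for a
  have "x - (\<Sum>b<n. c b *s u b) \<in> N'" using c incl(2) by blast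
  moreover have "(\<Sum>b<n. c b *s u b) - (\<Sum>a<n. e a *s u' a) \<in> N'"
    unfolding e_def by (rule sum_change_basis[OF sub uA])
  ultimately have "(x - (\<Sum>b<n. c b *s u b)) + ((\<Sum>b<n. c b *s u b) - (\<Sum>a<n. e a *s u' a)) \<in> N'"
    by (rule rmod.subspace_add[OF sub])
  from rmod.subspace_diff[OF sub this y(1)] have "(x - y) - (\<Sum>a<n. e a *s u' a) \<in> N'" by (simp add: algebra_simps)
  moreover have "x - y \<in> M'" using \<open>x \<in> M\<close> incl y by (intro rmod.subspace_diff sM') auto
  ultimately have e: "t \<le> \<nu> (e a)" if "a < n" for a
    by (intro small_coords[OF split sub u' _ y(2) t _ that])
  have "t - \<nu> (Determinant.det A) \<le> \<nu> (c b)" if b: "b < n" for b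
  proof -
    have "(\<Sum>a<n. B b a * e a) = (\<Sum>a<n. \<Sum>b'<n. B b a * A $$ (a, b') * c b')"
      by (simp add: e_def sum_distrib_left mult.assoc)
    also have "\<dots> = (\<Sum>b'<n. (\<Sum>a<n. B b a * A $$ (a, b')) * c b')"
      by (subst sum.swap) (simp add: sum_distrib_right)
    also have "\<dots> = (\<Sum>b'<n. if b = b' then Determinant.det A * c b' else 0)"
      using b by (intro sum.cong) (auto simp: B)
    also have "\<dots> = Determinant.det A * c b" using b by simp
    finally have "t \<le> \<nu> (Determinant.det A * c b)"
      using \<nu>_sum[OF t, of "{..<n}" "\<lambda>a. B b a * e a"] e \<nu>_mult_ge by simp
    \<comment> \<open>The truncated product formula replaces division by D.\<close>
    then show ?thesis by (simp add: \<nu>_mult)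
  qed
  then have "(\<Sum>b<n. c b *s u b) \<in> small (t - \<nu> (Determinant.det A))"
    using t \<nu>_nonneg[of "Determinant.det A"]
    by (intro rmod.subspace_sum submodule_small small_scale) auto
  then show "\<exists>y\<in>N. x - y \<in> small (t - \<nu> (natural_det M N M' N' n))"
    unfolding D by (intro bexI[OF _ c]) simp
qed

text \<open>By the adjugate D M lies in T + H, so it is contained in \<open>L\<close> to precision
  t; D is then removed in coordinates of R^n/L. It is applied with \<open>T\<close> =
  \<open>tilde Fil i j\<close>, \<open>M\<close> = \<open>Fil i j\<close> and \<open>L\<close> =
  \<open>Fil' i j\<close>.\<close>

lemma natural_det_close_supset:
  fixes L :: "('r ^ 'n) set"
  assumes sub: "submodule H" "submodule L" and L: "split_module L k"
    and incl: "T \<subseteq> M" "H \<subseteq> L" and t: "t \<le> 1"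
    and qb: "quotient_basis T {0} n u0" "quotient_basis M H n u0'" and T: "submodule T" "close t T L"
    and UNIV: "split_module (UNIV :: ('r ^ 'n) set) N"
  shows "close (t - \<nu> (natural_det T {0} M H n)) M L"
  unfolding close_def
proof
  obtain u u' A where u: "quotient_basis T {0} n u" and u': "quotient_basis M H n u'"
    and A: "A \<in> carrier_mat n n" and uA: "\<forall>b<n. u b - (\<Sum>a<n. A $$ (a, b) *s u' a) \<in> H"
    and D: "natural_det T {0} M H n = Determinant.det A"
    by (rule natural_det_cases[OF qb incl(1)])
  obtain B where B: "\<forall>a<n. \<forall>b<n. (\<Sum>k<n. A $$ (a, k) * B k b) = (if a = b then Determinant.det A else 0)"
    and "\<forall>a<n. \<forall>b<n. (\<Sum>k<n. B a k * A $$ (k, b)) = (if a = b then Determinant.det A else 0)"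
    by (rule adjugate[OF A])
  let ?D = "Determinant.det A"
  obtain q where q: "quotient_basis UNIV L (N - k) q" using split_module_quotient[OF UNIV L] by blast
  fix x assume "x \<in> M"
  then obtain c where c: "x - (\<Sum>a<n. c a *s u' a) \<in> H" by (rule quotient_basis_coords[OF u'])
  define g where "g b = (\<Sum>a<n. B b a * c a)" for b
  have g: "(\<Sum>b<n. A $$ (a, b) * g b) = ?D * c a" if a: "a < n" for a
  proof -
    have "(\<Sum>b<n. A $$ (a, b) * g b) = (\<Sum>b<n. \<Sum>a'<n. A $$ (a, b) * B b a' * c a')"
      by (simp add: g_def sum_distrib_left mult.assoc)
    also have "\<dots> = (\<Sum>a'<n. (\<Sum>b<n. A $$ (a, b) * B b a') * c a')"
      by (subst sum.swap) (simp add: sum_distrib_right)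
    also have "\<dots> = (\<Sum>a'<n. if a = a' then ?D * c a' else 0)"
      using a by (intro sum.cong) (auto simp: B)
    also have "\<dots> = ?D * c a" using a by simp
    finally show ?thesis .
  qed
  \<comment> \<open>An element of \<open>T\<close> congruent to D x modulo \<open>H\<close>, given
    by Cramer's rule.\<close>
  define \<tau> where "\<tau> = (\<Sum>b<n. g b *s u b)"
  have "\<tau> \<in> T" unfolding \<tau>_def
    by (intro rmod.subspace_sum rmod.subspace_scale T) (use quotient_basis_mem[OF u] in auto)
  then obtain l where l: "l \<in> L" "\<tau> - l \<in> small t" using T(2) unfolding close_def by blast
  have "(\<Sum>a<n. (\<Sum>b<n. A $$ (a, b) * g b) *s u' a) = ?D *s (\<Sum>a<n. c a *s u' a)"
    by (simp add: g rmod.scale_sum_right vector_smult_assoc)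
  with sum_change_basis[OF sub(1) uA, of g] have "\<tau> - ?D *s (\<Sum>a<n. c a *s u' a) \<in> H"
    by (simp add: \<tau>_def)
  from rmod.subspace_diff[OF sub(1) rmod.subspace_scale[OF sub(1) c, of ?D] this]
  have "?D *s x - \<tau> \<in> H" by (simp add: vector_ssub_ldistrib)
  then have Dx: "?D *s x - \<tau> \<in> L" using incl(2) by blast
  obtain e where e: "x - (\<Sum>a<N-k. e a *s q a) \<in> L" by (rule quotient_basis_coords[OF q UNIV_I])
  \<comment> \<open>Modulo \<open>L\<close>, the vector D x is represented by the small vector
    \<tau> - l, so its coordinates D e have value at least t.\<close>
  have "?D *s (x - (\<Sum>a<N-k. e a *s q a)) - (?D *s x - \<tau>) - l \<in> L"
    by (rule rmod.subspace_diff[OF sub(2) rmod.subspace_diff[OF sub(2) rmod.subspace_scale[OF sub(2) e] Dx] l(1)])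
  then have "(\<tau> - l) - (\<Sum>a<N-k. (?D * e a) *s q a) \<in> L"
    by (simp add: vector_ssub_ldistrib rmod.scale_sum_right vector_smult_assoc algebra_simps)
  then have "t \<le> \<nu> (?D * e a)" if "a < N - k" for a
    by (rule small_coords[OF UNIV sub(2) q UNIV_I l(2) t _ that])
  then have "t - \<nu> ?D \<le> \<nu> (e a)" if "a < N - k" for a using that by (fastforce simp: \<nu>_mult)
  then have "(\<Sum>a<N-k. e a *s q a) \<in> small (t - \<nu> ?D)"
    using t \<nu>_nonneg[of ?D] by (intro rmod.subspace_sum submodule_small small_scale) auto
  then show "\<exists>y\<in>L. x - y \<in> small (t - \<nu> (natural_det T {0} M H n))"
    unfolding D by (intro bexI[OF _ e]) simp
qed

end

section \<open>The truncated valuation on the reduced ring\<close>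

context reduced_integers
begin

lemma v_neq_MInf [simp]: "v x \<noteq> - \<infinity>"
  and v_eq_PInf_iff: "v x = \<infinity> \<longleftrightarrow> x = 0"
  and v_mult: "v (x * y) = v x + v y"
  and v_add: "min (v x) (v y) \<le> v (x + y)"
  using valuation_v unfolding valuation_def by blast+

lemma v_0 [simp]: "v 0 = \<infinity>"
  by (simp add: v_eq_PInf_iff)

lemma v_1 [simp]: "v 1 = 0"
proof -
  obtain r where r: "v 1 = ereal r" using v_neq_MInf[of 1] v_eq_PInf_iff[of 1] by (cases "v 1") auto
  with v_mult[of 1 1] have "ereal r = ereal (r + r)" by simp
  then show ?thesis using r by (simp add: zero_ereal_def)
qed

lemma v_minus [simp]: "v (- x) = v x"
proof -
  obtain r where r: "v (-1) = ereal r" using v_neq_MInf[of "-1"] v_eq_PInf_iff[of "-1"] by (cases "v (-1)") auto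
  with v_mult[of "-1" "-1"] have "ereal (r + r) = 0" by simp
  then have "v (-1) = 0" using r by (simp add: zero_ereal_def)
  then show ?thesis using v_mult[of "-1" x] by simp
qed

lemma val_ring_iff: "x \<in> val_ring v \<longleftrightarrow> 0 \<le> v x"
  by (simp add: val_ring_def)

lemma val_ring_closed:
  "1 \<in> val_ring v" "0 \<in> val_ring v"
  "x \<in> val_ring v \<Longrightarrow> - x \<in> val_ring v"
  "x \<in> val_ring v \<Longrightarrow> y \<in> val_ring v \<Longrightarrow> x + y \<in> val_ring v"
  "x \<in> val_ring v \<Longrightarrow> y \<in> val_ring v \<Longrightarrow> x - y \<in> val_ring v"
  "x \<in> val_ring v \<Longrightarrow> y \<in> val_ring v \<Longrightarrow> x * y \<in> val_ring v"
  using order_trans[OF _ v_add[of x y], of 0] order_trans[OF _ v_add[of x "-y"], of 0]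
  by (auto simp: val_ring_iff v_mult)

lemma red_1: "red 1 = 1"
  and red_add: "x \<in> val_ring v \<Longrightarrow> y \<in> val_ring v \<Longrightarrow> red (x + y) = red x + red y"
  and red_mult: "x \<in> val_ring v \<Longrightarrow> y \<in> val_ring v \<Longrightarrow> red (x * y) = red x * red y"
  and red_surj: "\<exists>x\<in>val_ring v. red x = a"
  and red_eq_0: "x \<in> val_ring v \<Longrightarrow> red x = 0 \<longleftrightarrow> x \<in> (\<lambda>x. of_nat p * x) ` val_ring v"
proof -
  note q = quotient_red[unfolded quotient_map_def]
  show "red 1 = 1" using q by blast
  show "x \<in> val_ring v \<Longrightarrow> y \<in> val_ring v \<Longrightarrow> red (x + y) = red x + red y" using q by blast
  show "x \<in> val_ring v \<Longrightarrow> y \<in> val_ring v \<Longrightarrow> red (x * y) = red x * red y" using q by blast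
  have "a \<in> red ` val_ring v" using q by simp
  then show "\<exists>x\<in>val_ring v. red x = a" by auto
  have "{x \<in> val_ring v. red x = 0} = (\<lambda>x. of_nat p * x) ` val_ring v" using q by simp
  then show "x \<in> val_ring v \<Longrightarrow> red x = 0 \<longleftrightarrow> x \<in> (\<lambda>x. of_nat p * x) ` val_ring v" by auto
qed

text \<open>Two lifts differ by a multiple of p, of valuation at least 1, so a comparison with a
  threshold t \<le> 1 does not depend on the lift picked by \<open>SOME\<close>.\<close>

lemma red_val_ge:
  assumes x: "x \<in> val_ring v" and t: "t \<le> 1"
  shows "t \<le> red_val v red (red x) \<longleftrightarrow> ereal t \<le> v x"
proof -
  define y where "y = (SOME y. y \<in> val_ring v \<and> red y = red x)"
  have "y \<in> val_ring v \<and> red y = red x" unfolding y_def by (rule someI[of _ x]) (simp add: x)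
  then have y: "y \<in> val_ring v" "red y = red x" by auto
  have "red x = red (x - y) + red y" using red_add[OF val_ring_closed(5)[OF x y(1)] y(1)] by simp
  then have "red (x - y) = 0" using y by simp
  then obtain z where z: "z \<in> val_ring v" "x - y = of_nat p * z"
    using red_eq_0[OF val_ring_closed(5)[OF x y(1)]] by auto
  have "v (x - y) = 1 + v z" using z v_p v_mult by simp
  then have xy: "1 \<le> v (x - y)" using z(1) by (simp add: val_ring_iff add_increasing2)
  have "ereal t \<le> 1" using t by simp
  then have "ereal t \<le> v (x - y)" using xy by (rule order_trans)
  then have "ereal t \<le> v x \<longleftrightarrow> ereal t \<le> v y"
    using order_trans[OF _ v_add[of "x - y" y], of "ereal t"] order_trans[OF _ v_add[of "- (x - y)" x], of "ereal t"]
    by (auto simp del: minus_diff_eq)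
  \<comment> \<open>The minimum lies between 0 and 1, so the conversion to a real loses nothing,
    even for y = 0.\<close>
  moreover have "t \<le> real_of_ereal (min (v y) 1) \<longleftrightarrow> ereal t \<le> v y"
    using t y(1) by (cases "v y") (auto simp: min_def val_ring_iff one_ereal_def zero_ereal_def)
  ultimately show ?thesis unfolding red_val_def y_def by simp
qed

lemma red_of_nat: "red (of_nat m) = of_nat m" "of_nat m \<in> val_ring v"
proof -
  have "red (of_nat m) = of_nat m \<and> of_nat m \<in> val_ring v"
  proof (induction m)
    case 0
    have "red 0 = 0" using red_eq_0[OF val_ring_closed(2)] val_ring_closed(2) by auto
    then show ?case by (simp add: val_ring_closed)
  next
    case (Suc m) then show ?case using red_add[of 1 "of_nat m"] by (auto simp: red_1 val_ring_closed)
  qed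
  then show "red (of_nat m) = of_nat m" "of_nat m \<in> val_ring v" by auto
qed

lemma CHAR_reduced: "CHAR('r) = p"
proof -
  have "red (of_nat p) = 0" using red_eq_0[OF red_of_nat(2)] val_ring_closed(1) by force
  then have "CHAR('r) dvd p" by (simp add: red_of_nat of_nat_eq_0_iff_char_dvd)
  moreover have "CHAR('r) \<noteq> 1" by (simp add: CHAR_not_1')
  ultimately show ?thesis using prime_p by (auto simp: prime_nat_iff)
qed

sublocale frobenius_valuation "red_val v red" p
proof
  let ?n = "red_val v red"
  fix a b :: 'r
  obtain x where x: "x \<in> val_ring v" "red x = a" using red_surj by blast
  obtain y where y: "y \<in> val_ring v" "red y = b" using red_surj by blast
  note ge = red_val_ge[OF x(1), unfolded x(2)] red_val_ge[OF y(1), unfolded y(2)]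
  show nonneg: "0 \<le> ?n a" using ge(1)[of 0] x(1) by (simp add: val_ring_iff zero_ereal_def)
  have le1: "?n c \<le> 1" for c
  proof -
    have "real_of_ereal (min e 1) \<le> 1" for e :: ereal
      by (cases e) (auto simp: min_def one_ereal_def)
    then show ?thesis unfolding red_val_def by blast
  qed
  then show "?n a \<le> 1" .
  show "?n 0 = 1" using red_val_ge[OF val_ring_closed(2), of 1] red_of_nat(1)[of 0] le1[of 0] by simp
  show one: "?n 1 = 0"
  proof (rule antisym)
    have "\<not> t \<le> ?n 1" if "0 < t" "t \<le> 1" for t
      using red_val_ge[OF val_ring_closed(1), of t] that by (simp add: red_1 zero_ereal_def)
    then show "?n 1 \<le> 0" using le1[of 1] by (metis linorder_not_le order_refl)
    show "0 \<le> ?n 1" using red_val_ge[OF val_ring_closed(1), of 0] by (simp add: red_1 zero_ereal_def)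
  qed
  show "min (?n a) (?n b) \<le> ?n (a + b)"
  proof -
    let ?t = "min (?n a) (?n b)"
    have t: "?t \<le> 1" using le1[of a] by simp
    have "ereal ?t \<le> v x" "ereal ?t \<le> v y" using ge(1)[OF t] ge(2)[OF t] by auto
    then have "ereal ?t \<le> v (x + y)" using v_add[of x y] by (meson min.boundedI order_trans)
    then show ?thesis
      using red_val_ge[OF val_ring_closed(4)[OF x(1) y(1)] t] x y by (simp add: red_add)
  qed
  have mult_ge: "t \<le> ?n (a * b) \<longleftrightarrow> ereal t \<le> v x + v y" if "t \<le> 1" for t
    using red_val_ge[OF val_ring_closed(6)[OF x(1) y(1)] that] x y by (simp add: red_mult v_mult)
  have n: "?n a = real_of_ereal (min (v x) 1)" "?n b = real_of_ereal (min (v y) 1)"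
  proof -
    have *: "?n c = real_of_ereal (min (v z) 1)" if z: "z \<in> val_ring v" "red z = c" for c z
    proof (rule antisym)
      have "ereal (?n c) \<le> v z" using red_val_ge[OF z(1) le1[of c]] z(2) by simp
      then show "?n c \<le> real_of_ereal (min (v z) 1)"
        using le1[of c] by (cases "v z") (auto simp: min_def one_ereal_def)
      have "real_of_ereal (min (v z) 1) \<le> 1" "ereal (real_of_ereal (min (v z) 1)) \<le> v z"
        using z(1) by (cases "v z"; auto simp: min_def one_ereal_def val_ring_iff)+
      then show "real_of_ereal (min (v z) 1) \<le> ?n c" using red_val_ge[OF z(1)] z(2) by blast
    qed
    show "?n a = real_of_ereal (min (v x) 1)" by (rule *[OF x])
    show "?n b = real_of_ereal (min (v y) 1)" by (rule *[OF y])
  qed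
  show "?n (a * b) = min (?n a + ?n b) 1"
  proof -
    have "t \<le> ?n (a * b) \<longleftrightarrow> t \<le> min (?n a + ?n b) 1" if "t \<le> 1" for t
      unfolding mult_ge[OF that] n using that x(1) y(1)
      by (cases "v x"; cases "v y") (auto simp: min_def one_ereal_def val_ring_iff zero_ereal_def)
    from this[of "?n (a * b)"] this[of "min (?n a + ?n b) 1"] show ?thesis
      using le1[of "a * b"] by (auto intro!: antisym)
  qed
  \<comment> \<open>A lift of valuation 0 has an integral inverse, whose reduction inverts
    \<open>a\<close>.\<close>
  show "a dvd 1" if "?n a = 0"
  proof -
    have "v x = 0"
    proof (rule antisym)
      have "real_of_ereal (min (v x) 1) = 0" using that n(1) by simp
      then show "v x \<le> 0"
        by (cases "v x"; auto simp: min_def one_ereal_def zero_ereal_def split: if_splits)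
    qed (use x(1) in \<open>simp add: val_ring_iff\<close>)
    then have "x \<noteq> 0" by auto
    then have "v x + v (inverse x) = 0" using v_mult[of x "inverse x"] by simp
    then have "inverse x \<in> val_ring v" using \<open>v x = 0\<close> by (simp add: val_ring_iff)
    then have "red (x * inverse x) = a * red (inverse x)" using red_mult[OF x(1)] x(2) by simp
    then have "1 = a * red (inverse x)" using \<open>x \<noteq> 0\<close> by (simp add: red_1)
    then show ?thesis by (rule dvdI)
  qed
  show "0 < p" using prime_p by (rule prime_gt_0_nat)
  show "(a + b) ^ p = a ^ p + b ^ p"
    by (rule freshmans_dream) (simp_all add: CHAR_reduced prime_p)
qed

text \<open>Smallness refers to the standard coordinates of R^n. The dual family of \<open>M\<close>
  turns it into smallness of the coordinates in a basis of \<open>M\<close>, which then lift to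
  \<open>val_ideal v t\<close>.\<close>

lemma small_subset_ideal_times:
  assumes M: "split_module M k" and x: "x \<in> M" "x \<in> small t" and t: "t \<le> 1"
  shows "x \<in> ideal_times v red t M"
proof -
  obtain S \<mu> where S: "finite S" "card S = k" "dual_on S \<mu>" "rspan S = M"
    using M unfolding split_module_def by blast
  have "\<exists>a\<in>val_ideal v t. red a = vdot (\<mu> s) x" for s
  proof -
    obtain a where a: "a \<in> val_ring v" "red a = vdot (\<mu> s) x" using red_surj by blast
    then have "ereal t \<le> v a" using red_val_ge[OF a(1) t] small_vdot[OF t x(2), of "\<mu> s"] by simp
    then show ?thesis using a unfolding val_ideal_def by blast
  qed
  then obtain r where r: "\<And>s. r s \<in> val_ideal v t" "\<And>s. red (r s) = vdot (\<mu> s) x" by metis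
  have "x = (\<Sum>s\<in>S. red (r s) *s s)" unfolding r(2) using x(1) S by (intro dual_on_expand) auto
  also have "\<dots> \<in> ideal_times v red t M" unfolding ideal_times_def
    using r(1) S(4) rmod.span_superset[of S] by (intro rmod.span_sum rmod.span_base) blast
  finally show ?thesis .
qed

end

section \<open>Finite fields, the standard basis and equality of matrices\<close>

text \<open>Multiplication by a nonzero x permutes the nonzero elements, so their product can be
  cancelled.\<close>

lemma finite_field_power_card:
  fixes x :: "'c::{field,finite}"
  shows "x ^ CARD('c) = x"
proof (cases "x = 0")
  case False
  let ?U = "UNIV - {0 :: 'c}"
  have "bij_betw ((*) x) ?U ?U"
    by (rule bij_betwI[where g = "\<lambda>y. y / x"]) (use False in auto)
  then have "(\<Prod>y\<in>?U. x * y) = \<Prod>?U"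
    by (rule prod.reindex_bij_betw)
  then have "x ^ card ?U * \<Prod>?U = \<Prod>?U" by (simp add: prod.distrib)
  then have "x ^ (CARD('c) - 1) = 1" by (simp add: card_Diff_singleton)
  then have "x ^ (CARD('c) - 1) * x = x" by simp
  then show ?thesis by (simp only: power_minus_mult[OF zero_less_card_finite])
qed (simp add: zero_power)

lemma split_module_UNIV: "split_module (UNIV :: ('r::comm_ring_1 ^ 'n) set) CARD('n)"
proof -
  let ?b = "\<lambda>k. axis k 1 :: 'r ^ 'n"
  have inj: "inj ?b" by (rule injI) (simp add: axis_eq_axis)
  have "vdot (?b k) (?b l) = (if k = l then 1 else 0)" for k l
    by (simp add: vdot_def axis_def if_distrib[of "\<lambda>x. x * _"] cong: if_cong)
  then have "dual_on (range ?b) (\<lambda>x. x)"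
    unfolding dual_on_def by (auto simp: axis_eq_axis)
  moreover have "x \<in> rspan (range ?b)" for x
    by (subst vec_axis_expand, intro rmod.span_sum rmod.span_scale rmod.span_base) simp
  ultimately show ?thesis unfolding split_module_def
    using card_image[OF inj] by (intro exI[of _ "range ?b"] exI[of _ "\<lambda>x. x"]) auto
qed

lemma matrix_eqI:
  fixes A B :: "'r::comm_ring_1 ^ 'n ^ 'm"
  assumes "\<And>x. A *v x = B *v x"
  shows "A = B"
proof -
  have "vec_nth (vec_nth C a) b = vec_nth (C *v axis b 1) a" for C :: "'r ^ 'n ^ 'm" and a b
    by (simp add: matrix_vector_mult_def axis_def if_distrib[of "(*) _"] cong: if_cong)
  then show ?thesis using assms by (simp add: Finite_Cartesian_Product.vec_eq_iff)
qed

lemma prv_mem: "i \<in> {1..f} \<Longrightarrow> prv f i \<in> {1..f}"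
  by (auto simp: prv_def)

section \<open>Isotypic components and their projections\<close>

context dieudonne_module
begin

abbreviation chi :: "nat \<Rightarrow> 'f \<Rightarrow> 'r" where
  "chi i a \<equiv> \<kappa> (res ((\<sigma> ^^ i) a))"

lemma E_iff: "x \<in> E i \<longleftrightarrow> (\<forall>a\<in>val_ring vF. \<rho> a *v x = chi i a *s x)"
  unfolding E_def isotypic_def by simp

lemma submodule_E: "submodule (E i)"
  by (rule rmod.subspaceI) (auto simp: E_iff matrix_vector_add matrix_vector_scale vector_add_ldistrib vector_smult_assoc mult.commute)

definition is_decomp :: "'r ^ 'n \<Rightarrow> (nat \<Rightarrow> 'r ^ 'n) \<Rightarrow> bool" where
  "is_decomp x y \<longleftrightarrow>
     (\<forall>i\<in>{1..f}. y i \<in> E i) \<and> (\<forall>i. i \<notin> {1..f} \<longrightarrow> y i = 0) \<and> x = (\<Sum>i=1..f. y i)"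

definition decomp :: "'r ^ 'n \<Rightarrow> nat \<Rightarrow> 'r ^ 'n" where
  "decomp x = (THE y. is_decomp x y)"

lemma ex1_decomp: "\<exists>!y. is_decomp x y"
  using sum_E unfolding direct_sum_def is_decomp_def by blast

lemma decomp: "is_decomp x (decomp x)"
  unfolding decomp_def by (rule theI'[OF ex1_decomp])

lemma decomp_eq: "is_decomp x y \<Longrightarrow> decomp x = y"
  unfolding decomp_def by (rule the1_equality[OF ex1_decomp])

lemma decomp_single:
  assumes "l \<in> {1..f}" "x \<in> E l"
  shows "decomp x = (\<lambda>m. if m = l then x else 0)"
proof (rule decomp_eq)
  have "(\<Sum>i=1..f. if i = l then x else 0) = x" using assms(1) by simp
  then show "is_decomp x (\<lambda>m. if m = l then x else 0)"
    using assms rmod.subspace_0[OF submodule_E] by (auto simp: is_decomp_def)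
qed

lemma decomp_linear: "module_hom (*s) (*s) (\<lambda>x. decomp x l)"
proof unfold_locales
  fix x y :: "'r ^ 'n" and c :: 'r
  note D = decomp[unfolded is_decomp_def]
  have "is_decomp (x + y) (\<lambda>l. decomp x l + decomp y l)"
    using D[of x] D[of y] by (auto simp: is_decomp_def sum.distrib intro!: rmod.subspace_add[OF submodule_E])
  then show "decomp (x + y) l = decomp x l + decomp y l" using decomp_eq by metis
  have "c *s x = (\<Sum>i=1..f. c *s decomp x i)" using D[of x] by (metis rmod.scale_sum_right)
  then have "is_decomp (c *s x) (\<lambda>l. c *s decomp x l)"
    using D[of x] by (auto simp: is_decomp_def intro!: rmod.subspace_scale[OF submodule_E])
  then show "decomp (c *s x) l = c *s decomp x l" using decomp_eq by metis
qed

definition proj :: "nat \<Rightarrow> 'r ^ 'n ^ 'n" where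
  "proj l = (SOME A. \<forall>x. A *v x = decomp x l)"

lemma proj: "proj l *v x = decomp x l"
proof -
  obtain A where "\<forall>x. A *v x = decomp x l"
    by (rule matrix_of_linear[OF decomp_linear[of l]]) blast
  then have "\<forall>x. proj l *v x = decomp x l" unfolding proj_def by (rule someI)
  then show ?thesis by (rule spec)
qed

lemma proj_mem: "l \<in> {1..f} \<Longrightarrow> proj l *v x \<in> E l"
  using decomp[of x] unfolding proj is_decomp_def by blast

lemma proj_id: "l \<in> {1..f} \<Longrightarrow> x \<in> E l \<Longrightarrow> proj l *v x = x"
  by (simp add: proj decomp_single)

lemma proj_0: "m \<in> {1..f} \<Longrightarrow> l \<noteq> m \<Longrightarrow> x \<in> E m \<Longrightarrow> proj l *v x = 0"
  by (simp add: proj decomp_single)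

lemma sum_proj: "(\<Sum>l=1..f. proj l *v x) = x"
  using decomp[of x] unfolding proj is_decomp_def by (elim conjE) (rule sym)

lemma sum_proj_mat: "(\<Sum>l=1..f. proj l) = Finite_Cartesian_Product.mat 1"
  by (rule matrix_eqI) (simp only: sum_matrix_vector sum_proj matrix_vector_mul_lid)

text \<open>A decomposition of an element of \<open>\<omega>\<close> along the \<open>H i\<close> is
  also one along the \<open>E i\<close>, and the latter is unique.\<close>

lemma proj_H: "l \<in> {1..f} \<Longrightarrow> x \<in> \<omega> \<Longrightarrow> proj l *v x \<in> H l"
proof -
  assume l: "l \<in> {1..f}" and x: "x \<in> \<omega>"
  obtain y where y: "\<forall>i\<in>{1..f}. y i \<in> H i" "\<forall>i. i \<notin> {1..f} \<longrightarrow> y i = 0" "x = (\<Sum>i=1..f. y i)"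
    using sum_H x unfolding direct_sum_def by blast
  then have "is_decomp x y" by (auto simp: is_decomp_def H_def)
  then show "proj l *v x \<in> H l" using y(1) l by (simp add: proj decomp_eq)
qed

lemma split_E: "i \<in> {1..f} \<Longrightarrow> split_module (E i) h"
  by (rule split_module_of_projection[OF free_E proj_mem proj_id])

lemma split_direct_factor:
  assumes "i \<in> {1..f}" "direct_factor (E i) N k"
  shows "split_module N k"
proof -
  obtain A where "\<And>x. A *v x \<in> N" "\<And>x. x \<in> N \<Longrightarrow> A *v x = x"
    using direct_factor_projection[OF assms(2) proj_mem[OF assms(1)] proj_id[OF assms(1)]] by blast
  moreover have "free_of_rank N k" using assms(2) unfolding direct_factor_def by blast
  ultimately show ?thesis using split_module_of_projection by blast
qed

lemma direct_factor_subset: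
  assumes "direct_factor M N k"
  shows "N \<subseteq> M"
proof
  fix x assume "x \<in> N"
  moreover obtain C where "submodule C" "M = {x + y |x y. x \<in> N \<and> y \<in> C}"
    using assms unfolding direct_factor_def by blast
  ultimately show "x \<in> M" using rmod.subspace_0[of C] by force
qed

section \<open>Frobenius and Verschiebung on isotypic components\<close>

lemma \<sigma>_val_ring: "a \<in> val_ring vF \<Longrightarrow> (\<sigma> ^^ i) a \<in> val_ring vF"
  by (induction i) (simp_all add: val_ring_def vF_\<sigma>)

lemma res_\<sigma>_pow: "a \<in> val_ring vF \<Longrightarrow> res ((\<sigma> ^^ i) a) = res a ^ (p ^ i)"
  by (induction i) (simp_all add: res_\<sigma> \<sigma>_val_ring power_mult[symmetric] mult.commute)

lemma res_pow_card: "x ^ (p ^ f) = (x :: 'c)"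
  using finite_field_power_card[of x] by (simp add: card_residue_field)

text \<open>Only i = 1 has content: there the index wraps around to \<open>f\<close>, and the f-th
  power of Frobenius is trivial on a residue field with p^f elements.\<close>

lemma res_\<sigma>_Suc_prv:
  assumes "i \<in> {1..f}" "a \<in> val_ring vF"
  shows "res ((\<sigma> ^^ Suc (prv f i)) a) = res ((\<sigma> ^^ i) a)"
proof (cases "i = 1")
  case True
  have "res ((\<sigma> ^^ Suc f) a) = res ((\<sigma> ^^ f) a) ^ p" by (simp add: res_\<sigma> \<sigma>_val_ring assms)
  also have "\<dots> = res (\<sigma> a)" using assms by (simp add: res_\<sigma>_pow res_pow_card res_\<sigma>)
  finally show ?thesis using True by (simp add: prv_def)
qed (use assms in \<open>simp add: prv_def\<close>)

text \<open>This is why the twist of \<open>E l\<close> is isotypic of index l + 1.\<close>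

lemma chi_Suc:
  assumes "a \<in> val_ring vF"
  shows "chi (Suc i) a = chi i a ^ p"
proof -
  interpret comm_ring_hom \<kappa> by (rule k_algebra)
  show ?thesis using assms by (simp add: res_\<sigma> \<sigma>_val_ring hom_power)
qed

lemma frob_\<rho>_twist_E:
  assumes "x \<in> twist p (E l)" "a \<in> val_ring vF"
  shows "frob_mat p (\<rho> a) *v x = chi (Suc l) a *s x"
proof -
  have "twist p (E l) \<subseteq> {x. frob_mat p (\<rho> a) *v x = chi (Suc l) a *s x}"
  proof (rule K.twist_subset)
    show "submodule {x. frob_mat p (\<rho> a) *v x = chi (Suc l) a *s x}"
      by (rule rmod.subspaceI)
        (auto simp: matrix_vector_add matrix_vector_scale vector_add_ldistrib vector_smult_assoc mult.commute)
    fix x assume "x \<in> E l"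
    then have "\<rho> a *v x = chi l a *s x" using assms(2) by (simp add: E_iff)
    then have "frob_mat p (\<rho> a) *v frob_vec p x = chi l a ^ p *s frob_vec p x"
      by (metis K.frob_vec_mult K.frob_vec_scale)
    then show "frob_vec p x \<in> {x. frob_mat p (\<rho> a) *v x = chi (Suc l) a *s x}"
      using chi_Suc[OF assms(2)] by simp
  qed
  then show ?thesis using assms(1) by blast
qed

lemma Fr_twist_E:
  assumes "i \<in> {1..f}" "x \<in> twist p (E (prv f i))"
  shows "Fr *v x \<in> E i"
  unfolding E_iff
proof
  fix a assume a: "a \<in> val_ring vF"
  have "\<rho> a *v (Fr *v x) = Fr *v (frob_mat p (\<rho> a) *v x)"
    by (simp add: matrix_vector_mul_assoc \<rho>_Fr a)
  also have "\<dots> = chi i a *s (Fr *v x)"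
    using frob_\<rho>_twist_E[OF assms(2) a] res_\<sigma>_Suc_prv[OF assms(1) a] by (simp add: matrix_vector_scale)
  finally show "\<rho> a *v (Fr *v x) = chi i a *s (Fr *v x)" .
qed

text \<open>Distinct embeddings have distinct reductions; here this is read off the directness of the
  sum of the isotypic components.\<close>

lemma residues_distinct:
  assumes "0 < h" "l \<in> {1..f}" "m \<in> {1..f}" "l \<noteq> m"
  shows "\<exists>a\<in>val_ring vF. res ((\<sigma> ^^ l) a) \<noteq> res ((\<sigma> ^^ m) a)"
proof (rule ccontr)
  assume "\<not> ?thesis"
  then have "E l = E m" by (auto simp: E_iff)
  obtain B where B: "card B = h" "rmod.independent B" "rspan B = E l"
    using free_E[OF assms(2)] unfolding free_of_rank_def by blast
  then obtain b where "b \<in> B" using assms(1) by fastforce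
  then have "b \<noteq> 0" "b \<in> E l" using B rmod.dependent_zero[of B] rmod.span_base[of b B] by auto
  then have "proj m *v b = b" "proj m *v b = 0"
    using proj_id[OF assms(3)] proj_0[OF assms(2)] assms(4) \<open>E l = E m\<close> by auto
  then show False using \<open>b \<noteq> 0\<close> by simp
qed

text \<open>Residues distinct at \<open>l\<close> and \<open>prv f i\<close> stay distinct after the
  p-th power, which is injective on the finite residue field. Their difference is invertible there,
  and \<open>\<kappa>\<close> carries the inverse to \<open>'r\<close>.\<close>

lemma chi_diff_unit:
  assumes h: "0 < h" and i: "i \<in> {1..f}" and l: "l \<in> {1..f}" "l \<noteq> prv f i"
  obtains a e where "a \<in> val_ring vF" "e * (chi (Suc l) a - chi i a) = 1"
proof -
  obtain a where a: "a \<in> val_ring vF" "res ((\<sigma> ^^ l) a) \<noteq> res ((\<sigma> ^^ prv f i) a)"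
    using residues_distinct[OF h l(1) prv_mem[OF i] l(2)] by blast
  have inj: "x = y" if "x ^ p = y ^ p" for x y :: 'c
  proof -
    have "p * p ^ (f - 1) = p ^ f" using f_pos by (simp flip: power_Suc)
    then have "x ^ (p ^ f) = y ^ (p ^ f)" using that by (metis power_mult)
    then show ?thesis by (simp add: res_pow_card)
  qed
  let ?c = "res ((\<sigma> ^^ Suc l) a) - res ((\<sigma> ^^ i) a)"
  have "?c \<noteq> 0"
    using inj a res_\<sigma>_Suc_prv[OF i a(1)] by (auto simp: res_\<sigma> \<sigma>_val_ring)
  interpret comm_ring_hom \<kappa> by (rule k_algebra)
  have "\<kappa> (inverse ?c) * (chi (Suc l) a - chi i a) = \<kappa> (inverse ?c * ?c)"
    by (simp only: hom_mult hom_minus)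
  also have "\<dots> = 1" using \<open>?c \<noteq> 0\<close> by simp
  finally show ?thesis using that a(1) by blast
qed

lemma frob_proj_id:
  assumes "l \<in> {1..f}" "x \<in> twist p (E l)"
  shows "frob_mat p (proj l) *v x = x"
proof -
  have "twist p (E l) \<subseteq> {x. frob_mat p (proj l) *v x = x}"
  proof (rule K.twist_subset)
    show "submodule {x. frob_mat p (proj l) *v x = x}"
      by (rule rmod.subspaceI) (auto simp: matrix_vector_add matrix_vector_scale)
  qed (simp add: proj_id[OF assms(1)] flip: K.frob_vec_mult)
  then show ?thesis using assms(2) by blast
qed

lemma frob_proj_0:
  assumes "m \<in> {1..f}" "l \<noteq> m" "x \<in> twist p (E m)"
  shows "frob_mat p (proj l) *v x = 0"
proof -
  have "twist p (E m) \<subseteq> {x. frob_mat p (proj l) *v x = 0}"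
  proof (rule K.twist_subset)
    show "submodule {x. frob_mat p (proj l) *v x = 0}"
      by (rule rmod.subspaceI) (auto simp: matrix_vector_add matrix_vector_scale)
  qed (simp add: proj_0[OF assms(1,2)] K.frob_vec_0 flip: K.frob_vec_mult)
  then show ?thesis using assms(3) by blast
qed

lemma frob_proj_mem:
  assumes "l \<in> {1..f}"
  shows "frob_mat p (proj l) *v x \<in> twist p (E l)"
proof -
  have "frob_mat p (proj l) *v x \<in> twist p ((*v) (proj l) ` UNIV)"
    unfolding K.twist_image K.twist_UNIV by simp
  also have "\<dots> \<subseteq> twist p (E l)" using proj_mem[OF assms] by (intro K.twist_mono) auto
  finally show ?thesis .
qed

lemma sum_frob_proj: "(\<Sum>l=1..f. frob_mat p (proj l) *v x) = x"
  by (simp only: sum_matrix_vector[symmetric] K.frob_mat_sum[symmetric] sum_proj_mat K.frob_mat_1 matrix_vector_mul_lid)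

lemma twist_E_\<omega>:
  assumes "l \<in> {1..f}" "x \<in> twist p (E l)" "x \<in> twist p \<omega>"
  shows "x \<in> twist p (H l)"
proof -
  have "x \<in> (*v) (frob_mat p (proj l)) ` twist p \<omega>"
    using frob_proj_id[OF assms(1,2)] assms(3) by (metis imageI)
  also have "\<dots> \<subseteq> twist p (H l)" unfolding K.twist_image[symmetric]
    using proj_H[OF assms(1)] by (intro K.twist_mono) auto
  finally show ?thesis .
qed

lemma twist_H_subset: "twist p (H l) \<subseteq> twist p \<omega>" "twist p (H l) \<subseteq> twist p (E l)"
  by (intro K.twist_mono; auto simp: H_def)+

lemma proj_\<rho>:
  assumes "l \<in> {1..f}" "a \<in> val_ring vF"
  shows "\<rho> a *v (proj l *v x) = proj l *v (\<rho> a *v x)"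
proof -
  have scal: "\<rho> a *v (proj m *v x) = chi m a *s (proj m *v x)" if "m \<in> {1..f}" for m
    using proj_mem[OF that] assms(2) by (simp add: E_iff)
  have "proj l *v (\<rho> a *v x) = proj l *v (\<Sum>m=1..f. \<rho> a *v (proj m *v x))"
    by (simp only: sum_proj matrix_vector_sum[symmetric])
  also have "\<dots> = (\<Sum>m=1..f. if m = l then \<rho> a *v (proj l *v x) else 0)"
    unfolding matrix_vector_sum
  proof (rule sum.cong)
    fix m assume m: "m \<in> {1..f}"
    show "proj l *v (\<rho> a *v (proj m *v x)) = (if m = l then \<rho> a *v (proj l *v x) else 0)"
      using m scal[OF m] proj_mem[OF m, of x] by (auto simp: matrix_vector_scale proj_id proj_0)
  qed simp
  also have "\<dots> = \<rho> a *v (proj l *v x)" using assms(1) by simp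
  finally show ?thesis ..
qed

text \<open>The component of x in any other \<open>twist p (E l)\<close> is an eigenvector for two
  characters whose values at some a differ by a unit, hence it vanishes. This converts commutation
  of \<open>Ve\<close> with the action into compatibility with the grading.\<close>

lemma frob_isotypic:
  assumes h: "0 < h" and i: "i \<in> {1..f}"
    and x: "\<And>a. a \<in> val_ring vF \<Longrightarrow> frob_mat p (\<rho> a) *v x = chi i a *s x"
  shows "x \<in> twist p (E (prv f i))"
proof -
  have z: "frob_mat p (proj l) *v x = 0" if l: "l \<in> {1..f}" "l \<noteq> prv f i" for l
  proof -
    let ?y = "frob_mat p (proj l) *v x"
    obtain a e where a: "a \<in> val_ring vF" and e: "e * (chi (Suc l) a - chi i a) = 1"
      by (rule chi_diff_unit[OF h i l])
    have "\<rho> a ** proj l = proj l ** \<rho> a"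
      by (rule matrix_eqI) (simp add: proj_\<rho>[OF l(1) a] flip: matrix_vector_mul_assoc)
    then have "frob_mat p (\<rho> a) *v ?y = frob_mat p (proj l) *v (frob_mat p (\<rho> a) *v x)"
      by (simp add: matrix_vector_mul_assoc flip: K.frob_mat_mult)
    then have "chi (Suc l) a *s ?y = chi i a *s ?y"
      using frob_\<rho>_twist_E[OF frob_proj_mem[OF l(1)] a, of x] x[OF a] by (simp add: matrix_vector_scale)
    then have "(chi (Suc l) a - chi i a) *s ?y = 0" by (simp only: vector_sub_rdistrib diff_self)
    then have "(e * (chi (Suc l) a - chi i a)) *s ?y = 0" by (simp only: vector_smult_rzero flip: vector_smult_assoc)
    then show ?thesis by (simp only: e vector_smult_lid)
  qed
  have "x = (\<Sum>l=1..f. frob_mat p (proj l) *v x)" by (simp only: sum_frob_proj)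
  also have "\<dots> = (\<Sum>l=1..f. if l = prv f i then frob_mat p (proj l) *v x else 0)"
    by (rule sum.cong) (auto simp: z)
  also have "\<dots> = frob_mat p (proj (prv f i)) *v x" using prv_mem[OF i] by simp
  finally show ?thesis using frob_proj_mem[OF prv_mem[OF i], of x] by simp
qed

lemma Ve_E_mem:
  assumes "0 < h" "i \<in> {1..f}" "x \<in> E i"
  shows "Ve *v x \<in> twist p (E (prv f i))"
proof (rule frob_isotypic[OF assms(1,2)])
  fix a assume a: "a \<in> val_ring vF"
  have "frob_mat p (\<rho> a) *v (Ve *v x) = Ve *v (\<rho> a *v x)"
    by (simp add: matrix_vector_mul_assoc \<rho>_Ve a)
  then show "frob_mat p (\<rho> a) *v (Ve *v x) = chi i a *s (Ve *v x)"
    using assms(3) a by (simp add: E_iff matrix_vector_scale)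
qed

lemma Ve_image:
  assumes "0 < h" "i \<in> {1..f}"
  shows "(*v) Ve ` E i = twist p (H (prv f i))"
proof
  show "(*v) Ve ` E i \<subseteq> twist p (H (prv f i))"
    using Ve_E_mem[OF assms] twist_E_\<omega>[OF prv_mem[OF assms(2)]] image_Ve by blast
  show "twist p (H (prv f i)) \<subseteq> (*v) Ve ` E i"
  proof
    fix y assume y: "y \<in> twist p (H (prv f i))"
    then have "y \<in> range ((*v) Ve)" using twist_H_subset image_Ve by blast
    then obtain x where x: "y = Ve *v x" by blast
    have "y = frob_mat p (proj (prv f i)) *v y"
      using frob_proj_id[OF prv_mem[OF assms(2)]] y twist_H_subset by force
    \<comment> \<open>\<open>Ve\<close> sends the component \<open>l\<close> of x into the twist of
      index \<open>prv f l\<close>; as \<open>prv f\<close> is injective on {1..f}, only l = i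
      survives the projection.\<close>
    also have "\<dots> = (\<Sum>l=1..f. frob_mat p (proj (prv f i)) *v (Ve *v (proj l *v x)))"
      by (simp only: x sum_proj matrix_vector_sum[symmetric])
    also have "\<dots> = (\<Sum>l=1..f. if l = i then Ve *v (proj i *v x) else 0)"
    proof (rule sum.cong)
      fix l assume l: "l \<in> {1..f}"
      have *: "Ve *v (proj l *v x) \<in> twist p (E (prv f l))" by (rule Ve_E_mem[OF assms(1) l proj_mem[OF l]])
      have "prv f l \<noteq> prv f i" if "l \<noteq> i" using that l assms(2) by (auto simp: prv_def split: if_splits)
      then show "frob_mat p (proj (prv f i)) *v (Ve *v (proj l *v x)) = (if l = i then Ve *v (proj i *v x) else 0)"
        using frob_proj_id[OF prv_mem[OF l] *] frob_proj_0[OF prv_mem[OF l] _ *, of "prv f i"] by auto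
    qed simp
    also have "\<dots> = Ve *v (proj i *v x)" using assms(2) by simp
    finally show "y \<in> (*v) Ve ` E i" using proj_mem[OF assms(2)] by blast
  qed
qed

lemma Ve_kernel:
  assumes "i \<in> {1..f}"
  shows "{x \<in> E i. Ve *v x = 0} = (*v) Fr ` twist p (E (prv f i))"
proof
  show "(*v) Fr ` twist p (E (prv f i)) \<subseteq> {x \<in> E i. Ve *v x = 0}"
    using Fr_twist_E[OF assms] kernel_Ve by blast
  show "{x \<in> E i. Ve *v x = 0} \<subseteq> (*v) Fr ` twist p (E (prv f i))"
  proof
    fix x assume "x \<in> {x \<in> E i. Ve *v x = 0}"
    then have xE: "x \<in> E i" and "x \<in> range ((*v) Fr)" using kernel_Ve by blast+
    then obtain y where y: "x = Fr *v y" by blast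
    let ?q = "\<lambda>l. frob_mat p (proj l) *v y"
    have "x = proj i *v x" using proj_id[OF assms xE] by simp
    also have "\<dots> = proj i *v (Fr *v (\<Sum>l=1..f. ?q l))" by (simp only: sum_frob_proj y)
    also have "\<dots> = (\<Sum>l=1..f. proj i *v (Fr *v ?q l))" by (simp only: matrix_vector_sum)
    also have "\<dots> = (\<Sum>l=1..f. if l = prv f i then Fr *v ?q (prv f i) else 0)"
    proof (rule sum.cong)
      fix l assume l: "l \<in> {1..f}"
      \<comment> \<open>The successor of \<open>l\<close> in the cycle: \<open>Fr\<close> maps the
        twist of \<open>E l\<close> into \<open>E m\<close>.\<close>
      define m where "m = (if l = f then 1 else Suc l)"
      have m: "m \<in> {1..f}" "prv f m = l" using l by (auto simp: m_def prv_def)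
      have *: "Fr *v ?q l \<in> E m" using Fr_twist_E[OF m(1)] frob_proj_mem[OF l] m(2) by simp
      show "proj i *v (Fr *v ?q l) = (if l = prv f i then Fr *v ?q (prv f i) else 0)"
      proof (cases "l = prv f i")
        case True
        then have "m = i" using m assms by (auto simp: prv_def split: if_splits)
        then show ?thesis using proj_id[OF m(1) *] True by simp
      next
        case False
        then have "i \<noteq> m" using m by auto
        then show ?thesis using proj_0[OF m(1) _ *] False by simp
      qed
    qed simp
    also have "\<dots> = Fr *v ?q (prv f i)" using prv_mem[OF assms] by simp
    finally show "x \<in> (*v) Fr ` twist p (E (prv f i))" using frob_proj_mem[OF prv_mem[OF assms]] by blast
  qed
qed

lemma Fr_kernel:
  assumes "l \<in> {1..f}" "x \<in> twist p (E l)"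
  shows "Fr *v x = 0 \<longleftrightarrow> x \<in> twist p (H l)"
  using twist_E_\<omega>[OF assms] twist_H_subset(1)[of l] kernel_Fr by blast

end

section \<open>Jumps\<close>

lemma jump_list_props:
  "sorted_wrt (<) (jump_list f h d)" "set (jump_list f h d) = d ` {1..f} \<inter> {1..h - 1}"
  by (simp_all add: jump_list_def)

lemma jump_nth:
  assumes "j \<in> {1..jump_count f h d}"
  shows "jump f h d j \<in> d ` {1..f} \<inter> {1..h - 1}"
proof -
  have "jump f h d j = jump_list f h d ! (j - 1)" "j - 1 < length (jump_list f h d)"
    using assms by (auto simp: jump_def jump_count_def)
  then show ?thesis using nth_mem jump_list_props(2) by metis
qed

text \<open>Strictness, including the conventional end values 0 and h, gives the uniqueness behind
  the \<open>THE\<close> in \<open>jump_index\<close>. The condition 0 < h separates the two ends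
  when there is no jump in between.\<close>

lemma jump_less:
  assumes "0 < h" "a < b" "b \<le> jump_count f h d + 1"
  shows "jump f h d a < jump f h d b"
proof -
  have b: "jump f h d b = h" if "b = jump_count f h d + 1" using that by (simp add: jump_def)
  have mid: "0 < jump f h d j" "jump f h d j < h" if "j \<in> {1..jump_count f h d}" for j
    using jump_nth[OF that] assms(1) by auto
  show ?thesis
  proof (cases "a = 0")
    case True
    then have "jump f h d a = 0" by (simp add: jump_def)
    then show ?thesis using b mid(1)[of b] assms by (cases "b = jump_count f h d + 1") auto
  next
    case False
    show ?thesis
    proof (cases "b = jump_count f h d + 1")
      case True
      then show ?thesis using b mid(2)[of a] assms False by auto
    next
      case b': False
      have "jump_list f h d ! (a - 1) < jump_list f h d ! (b - 1)"
        by (rule sorted_wrt_nth_less[OF jump_list_props(1)])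
          (use assms False b' in \<open>auto simp: jump_count_def\<close>)
      then show ?thesis using assms False b' by (simp add: jump_def)
    qed
  qed
qed

lemma jump_inj:
  assumes "0 < h" "a \<le> jump_count f h d + 1" "b \<le> jump_count f h d + 1" "jump f h d a = jump f h d b"
  shows "a = b"
proof (rule ccontr)
  assume "a \<noteq> b"
  then consider "a < b" | "b < a" by linarith
  then show False
  proof cases
    case 1
    from jump_less[OF assms(1) this assms(3)] show False using assms(4) by simp
  next
    case 2
    from jump_less[OF assms(1) this assms(2)] show False using assms(4) by simp
  qed
qed

lemma jump_index_eqI:
  assumes "0 < h" "s \<le> jump_count f h d + 1" "d i = jump f h d s"
  shows "jump_index f h d i = s"
  unfolding jump_index_def
proof (rule the_equality)
  fix s' assume *: "s' \<le> jump_count f h d + 1 \<and> d i = jump f h d s'"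
  show "s' = s"
    by (rule jump_inj[OF assms(1) conjunct1[OF *] assms(2) trans[OF sym[OF conjunct2[OF *]] assms(3)]])
qed (intro conjI assms)

lemma jump_index:
  assumes "0 < h" "i \<in> {1..f}" "d i \<le> h"
  shows "jump_index f h d i \<le> jump_count f h d + 1" "d i = jump f h d (jump_index f h d i)"
proof -
  have "\<exists>s\<le>jump_count f h d + 1. d i = jump f h d s"
  proof (cases "d i = 0 \<or> d i = h")
    case True
    then show ?thesis
    proof
      assume "d i = 0" then show ?thesis by (intro exI[of _ 0]) (simp add: jump_def)
    next
      assume "d i = h" then show ?thesis
        by (intro exI[of _ "jump_count f h d + 1"]) (simp add: jump_def)
    qed
  next
    case False
    then have "d i \<in> set (jump_list f h d)" using assms unfolding jump_list_props(2) by auto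
    then obtain k where "k < jump_count f h d" "jump_list f h d ! k = d i"
      unfolding jump_count_def in_set_conv_nth by auto
    \<comment> \<open>Lists are indexed from 0 and jumps from 1.\<close>
    then show ?thesis by (intro exI[of _ "Suc k"]) (simp add: jump_def)
  qed
  then obtain s where s: "s \<le> jump_count f h d + 1" "d i = jump f h d s" by blast
  from jump_index_eqI[of h s f d i, OF assms(1) s]
  have "jump_index f h d i = s" .
  with s show "jump_index f h d i \<le> jump_count f h d + 1" "d i = jump f h d (jump_index f h d i)" by auto
qed

section \<open>Monotonicity of congruences and lifting of small vectors\<close>

context truncated_valuation
begin

lemma small_mono: "s \<le> t \<Longrightarrow> small t \<subseteq> small s"
  unfolding small_def by (auto intro: order_trans)

lemma close_mono: "close t N N' \<Longrightarrow> s \<le> t \<Longrightarrow> N2 \<subseteq> N \<Longrightarrow> N' \<subseteq> N2' \<Longrightarrow> close s N2 N2'"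
  using small_mono[of s t] unfolding close_def by blast

text \<open>Basis vectors of \<open>M\<close> are lifted arbitrarily; the lift of z reuses its small
  coordinates and is therefore small itself.\<close>

lemma small_lift:
  assumes M: "split_module M k" "(*v) A ` P = M" and P: "submodule P"
    and z: "z \<in> M" "z \<in> small t" and t: "t \<le> 1"
  obtains z' where "z' \<in> P" "z' \<in> small t" "A *v z' = z"
proof -
  obtain S \<mu> where S: "finite S" "card S = k" "dual_on S \<mu>" "rspan S = M"
    using M(1) unfolding split_module_def by blast
  have "\<forall>s\<in>S. \<exists>y. y \<in> P \<and> A *v y = s"
  proof
    fix s assume "s \<in> S"
    then have "s \<in> (*v) A ` P" using M(2) S(4) rmod.span_base[of s S] by simp
    then show "\<exists>y. y \<in> P \<and> A *v y = s" by (elim imageE) auto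
  qed
  from bchoice[OF this] obtain e where e: "\<forall>s\<in>S. e s \<in> P \<and> A *v e s = s" by (elim exE)
  let ?z = "\<Sum>s\<in>S. vdot (\<mu> s) z *s e s"
  have "A *v ?z = (\<Sum>s\<in>S. vdot (\<mu> s) z *s s)"
    unfolding matrix_vector_sum matrix_vector_scale by (rule sum.cong) (simp_all add: e)
  also have "\<dots> = z" using z(1) S by (intro dual_on_expand[symmetric]) auto
  finally have "A *v ?z = z" .
  moreover have "?z \<in> P" by (intro rmod.subspace_sum rmod.subspace_scale P) (use e in auto)
  moreover have "?z \<in> small t"
    by (intro rmod.subspace_sum submodule_small small_scale small_vdot t z)
  ultimately show ?thesis using that by blast
qed

end

section \<open>Ranks and quotients in adequate filtrations\<close>

context dieudonne_module
begin

abbreviation tilde :: "(nat \<Rightarrow> nat \<Rightarrow> ('r ^ 'n) set) \<Rightarrow> nat \<Rightarrow> nat \<Rightarrow> ('r ^ 'n) set" where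
  "tilde \<equiv> fil_tilde p f h d Fr Ve E"

abbreviation hodge_adequate :: "(nat \<Rightarrow> nat \<Rightarrow> ('r ^ 'n) set) \<Rightarrow> bool" where
  "hodge_adequate \<equiv> adequate p f h d Fr Ve E H"

lemma H_subset_E: "H i \<subseteq> E i"
  by (auto simp: H_def)

lemma split_H: "i \<in> {1..f} \<Longrightarrow> split_module (H i) (d i)"
  by (rule split_direct_factor[OF _ factor_H])

lemma d_le_h: "i \<in> {1..f} \<Longrightarrow> d i \<le> h"
  by (rule K.split_module_quotient(1)[OF split_E split_H H_subset_E])

text \<open>A jump lies in {1..h - 1}, so the mere existence of an index \<open>j\<close> forces h >
  0. The inequalities keep the truncated subtractions of ranks exact.\<close>

lemma jump_bounds:
  assumes "i \<in> {1..f}" "j \<in> {1..jump_count f h d}"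
  shows "0 < h" "jump f h d j \<le> h" "j \<le> jump_index f h d i \<Longrightarrow> jump f h d j \<le> d i"
    "jump_index f h d i < j \<Longrightarrow> d i \<le> jump f h d j"
proof -
  show h: "0 < h" "jump f h d j \<le> h" using jump_nth[OF assms(2)] by auto
  note s = jump_index[of h i f d, OF h(1) assms(1) d_le_h[OF assms(1)]]
  show "jump f h d j \<le> d i" if "j \<le> jump_index f h d i"
    using jump_less[OF h(1), of j "jump_index f h d i" f d] s that by (cases "j = jump_index f h d i") auto
  show "d i \<le> jump f h d j" if "jump_index f h d i < j"
    using jump_less[OF h(1) that, of f d] s assms(2) by auto
qed

lemma submodule_tilde: "submodule (tilde Fil i j)"
proof -
  have "submodule (E i \<inter> {x. Ve *v x \<in> twist p N})" for N
    by (intro rmod.subspace_inter submodule_E K.submodule_twist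
        module_hom.subspace_linear_preimage[OF module_hom_matrix])
  moreover have "submodule ((*v) Fr ` twist p N)" for N
    by (intro submodule_image K.submodule_twist)
  ultimately show ?thesis by (simp add: fil_tilde_def Collect_conj_eq)
qed

text \<open>The boundary j = s i is included: there the filtration step is {0} and the rank formula
  gives 0.\<close>

lemma adequate_low:
  assumes "hodge_adequate Fil" "i \<in> {1..f}" "j \<in> {1..jump_count f h d}" "j \<le> jump_index f h d i"
  shows "split_module (Fil i j) (d i - jump f h d j)" "Fil i j \<subseteq> H i" "Fil i j \<subseteq> tilde Fil i j"
proof -
  note ad = assms(1)[unfolded adequate_def Let_def, rule_format, OF assms(2)]
  consider "j < jump_index f h d i" | "j = jump_index f h d i" using assms(4) by linarith
  then have "split_module (Fil i j) (d i - jump f h d j) \<and> Fil i j \<subseteq> H i \<and> Fil i j \<subseteq> tilde Fil i j"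
  proof cases
    case 1
    then have "direct_factor (E i) (Fil i j) (d i - jump f h d j)" "Fil i j \<subseteq> H i" "Fil i j \<subseteq> tilde Fil i j"
      using ad assms(3) by auto
    then show ?thesis using split_direct_factor[OF assms(2)] by blast
  next
    case 2
    then have Fil: "Fil i j = {0}" using ad assms(3) by auto
    have "d i = jump f h d j"
      using jump_index(2)[of h i f d, OF jump_bounds(1)[OF assms(2,3)] assms(2) d_le_h[OF assms(2)]] 2 by simp
    moreover have "0 \<in> H i" "0 \<in> tilde Fil i j"
      using rmod.subspace_0[OF split_module_submodule[OF split_H[OF assms(2)]]]
        rmod.subspace_0[OF submodule_tilde] by auto
    ultimately show ?thesis using K.split_module_0 Fil by simp
  qed
  then show "split_module (Fil i j) (d i - jump f h d j)" "Fil i j \<subseteq> H i" "Fil i j \<subseteq> tilde Fil i j"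
    by auto
qed

lemma adequate_high:
  assumes "hodge_adequate Fil" "i \<in> {1..f}" "j \<in> {1..jump_count f h d}" "jump_index f h d i < j"
  shows "split_module (Fil i j) (h + d i - jump f h d j)" "Fil i j \<subseteq> E i" "H i \<subseteq> Fil i j"
    "tilde Fil i j \<subseteq> Fil i j"
proof -
  note ad = assms(1)[unfolded adequate_def Let_def, rule_format, OF assms(2)]
  have df: "direct_factor (E i) (Fil i j) (h + d i - jump f h d j)" and
    "H i \<subseteq> Fil i j" "tilde Fil i j \<subseteq> Fil i j"
    using ad assms(3,4) by auto
  then show "H i \<subseteq> Fil i j" "tilde Fil i j \<subseteq> Fil i j" by auto
  show "split_module (Fil i j) (h + d i - jump f h d j)" by (rule split_direct_factor[OF assms(2) df])
  show "Fil i j \<subseteq> E i" by (rule direct_factor_subset[OF df])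
qed

lemma adequate_subset_E:
  assumes "hodge_adequate Fil" "i \<in> {1..f}" "j \<in> {1..jump_count f h d}"
  shows "Fil i j \<subseteq> E i"
  using adequate_low(2)[OF assms] adequate_high(2)[OF assms] H_subset_E[of i]
  by (cases "j \<le> jump_index f h d i") auto

lemma adequate_split:
  assumes "hodge_adequate Fil" "hodge_adequate Fil'" "i \<in> {1..f}" "j \<in> {1..jump_count f h d}"
  obtains k where "split_module (Fil i j) k" "split_module (Fil' i j) k"
  using adequate_low(1)[OF assms(1,3,4)] adequate_high(1)[OF assms(1,3,4)]
    adequate_low(1)[OF assms(2,3,4)] adequate_high(1)[OF assms(2,3,4)]
  by (cases "j \<le> jump_index f h d i") (auto simp: not_le)

lemma tilde_subset_E:
  assumes "hodge_adequate Fil" "i \<in> {1..f}" "j \<in> {1..jump_count f h d}"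
  shows "tilde Fil i j \<subseteq> E i"
proof (cases "j \<le> jump_index f h d (prv f i)")
  case False
  have "Fil (prv f i) j \<subseteq> E (prv f i)" by (rule adequate_subset_E[OF assms(1) prv_mem[OF assms(2)] assms(3)])
  then show ?thesis
    using False Fr_twist_E[OF assms(2)] K.twist_mono[of "Fil (prv f i) j" "E (prv f i)"]
    unfolding fil_tilde_def by auto
qed (auto simp: fil_tilde_def)

text \<open>With \<open>K\<close> the kernel of Verschiebung on \<open>E i\<close>, the quotient \<open>E i / K\<close> is the twist of the
  previous \<open>H\<close>, and \<open>K\<close> is the quotient of the twist of the previous \<open>E\<close> by that of the
  previous \<open>H\<close>. In the first case \<open>tilde Fil i j\<close> contains \<open>K\<close>, in the second it is contained
  in \<open>K\<close>.\<close>

lemma tilde_quotient_bases: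
  assumes ad: "hodge_adequate Fil" and i: "i \<in> {1..f}" and j: "j \<in> {1..jump_count f h d}"
  shows "\<exists>u. quotient_basis (E i) (tilde Fil i j) (jump f h d j) u"
    and "\<exists>u. quotient_basis (tilde Fil i j) {0} (h - jump f h d j) u"
proof -
  let ?l = "prv f i" let ?N = "Fil ?l j" let ?T = "tilde Fil i j" let ?\<delta> = "jump f h d j"
  define Ki where "Ki = (*v) Fr ` twist p (E ?l)"
  have Ki: "Ki = {x \<in> E i. Ve *v x = 0}" unfolding Ki_def using Ve_kernel[OF i] by simp
  note l = prv_mem[OF i]
  note b = jump_bounds[OF l j]
  note h = b(1)
  have sub: "submodule (E i)" "submodule ?T" "submodule Ki" "submodule {0}"
    unfolding Ki_def by (intro submodule_E submodule_tilde submodule_image K.submodule_twist rmod.subspace_single_0)+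
  note spl = K.split_module_twist[OF split_E[OF l]] K.split_module_twist[OF split_H[OF l]]
  note im = Ve_image[OF h i]
  have ker: "x \<in> twist p (E ?l) \<Longrightarrow> Fr *v x = 0 \<Longrightarrow> x \<in> twist p (H ?l)" for x
    using Fr_kernel[OF l] by blast
  have zK: "{0} \<subseteq> Ki" using rmod.subspace_0[OF sub(3)] by simp
  have Fr0: "(*v) Fr ` twist p (H ?l) = {0}"
  proof -
    have "Fr *v x = 0" if "x \<in> twist p (H ?l)" for x
      using Fr_kernel[OF l] that twist_H_subset(2)[of ?l] by blast
    moreover have "0 \<in> twist p (H ?l)" by (rule rmod.subspace_0[OF K.submodule_twist])
    ultimately show ?thesis by force
  qed
  have "(\<exists>u. quotient_basis (E i) ?T ?\<delta> u) \<and> (\<exists>u. quotient_basis ?T {0} (h - ?\<delta>) u)"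
  proof (cases "j \<le> jump_index f h d ?l")
    case True
    then have T: "?T = {x \<in> E i. Ve *v x \<in> twist p ?N}" by (simp add: fil_tilde_def)
    note low = adequate_low[OF ad l j True]
    note sN = K.split_module_twist[OF low(1)]
    have N: "twist p ?N \<subseteq> twist p (H ?l)" by (rule K.twist_mono[OF low(2)])
    have zN: "{0} \<subseteq> twist p ?N" using rmod.subspace_0[OF K.submodule_twist, of ?N] by simp
    \<comment> \<open>E i / T is the quotient of the two twists through \<open>Ve\<close>, of rank d
      - (d - \<delta>) = \<delta>.\<close>
    obtain u1 where u1: "quotient_basis (twist p (H ?l)) (twist p ?N) (d ?l - (d ?l - ?\<delta>)) u1"
      using K.split_module_quotient(2)[OF spl(2) sN N] by (elim exE)
    have "d ?l - (d ?l - ?\<delta>) = ?\<delta>" using b(3)[OF True] by simp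
    then obtain u where u: "quotient_basis (E i) ?T ?\<delta> u"
      using quotient_basis_vimage[OF sub(1) K.submodule_twist im u1 T] by (simp only:) blast
    obtain u2 where u2: "quotient_basis (twist p ?N) {0} (d ?l - ?\<delta> - 0) u2"
      using K.split_module_quotient(2)[OF sN K.split_module_0 zN] by (elim exE)
    have imT: "(*v) Ve ` ?T = twist p ?N"
    proof
      show "twist p ?N \<subseteq> (*v) Ve ` ?T"
      proof
        fix y assume y: "y \<in> twist p ?N"
        then have "y \<in> (*v) Ve ` E i" using N im by auto
        then obtain x where "y = Ve *v x" "x \<in> E i" by (rule imageE)
        then show "y \<in> (*v) Ve ` ?T" using y by (simp add: T)
      qed
    qed (auto simp: T)
    have KiT: "Ki = {x \<in> ?T. Ve *v x \<in> {0}}" using zN unfolding T Ki by auto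
    \<comment> \<open>\<open>T\<close> is an extension of the twist of \<open>Fil\<close> by
      \<open>Ki\<close>, of total rank (d - \<delta>) + (h - d).\<close>
    obtain u3 where u3: "quotient_basis ?T Ki (d ?l - ?\<delta> - 0) u3"
      by (rule quotient_basis_vimage[OF sub(2,4) imT u2 KiT])
    obtain u4 where u4: "quotient_basis (twist p (E ?l)) (twist p (H ?l)) (h - d ?l) u4"
      using K.split_module_quotient(2)[OF spl(1,2) twist_H_subset(2)] by (elim exE)
    have K0: "quotient_basis Ki {0} (h - d ?l) (\<lambda>a. Fr *v u4 a)"
      unfolding Ki_def Fr0[symmetric]
      by (rule quotient_basis_image[OF K.submodule_twist K.submodule_twist twist_H_subset(2) ker u4])
    have "Ki \<subseteq> ?T" unfolding KiT by (rule Collect_restrict)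
    note T0 = quotient_basis_trans[OF sub(4,3,2) zK this u3 K0]
    have e: "d ?l - ?\<delta> - 0 + (h - d ?l) = h - ?\<delta>" using b(3)[OF True] d_le_h[OF l] by simp
    show ?thesis by (rule conjI, rule exI, rule u, rule exI, rule T0[unfolded e])
  next
    case False
    then have T: "?T = (*v) Fr ` twist p ?N" by (simp add: fil_tilde_def)
    have lt: "jump_index f h d ?l < j" using False by simp
    note high = adequate_high[OF ad l j lt]
    note sN = K.split_module_twist[OF high(1)]
    have N: "twist p ?N \<subseteq> twist p (E ?l)" "twist p (H ?l) \<subseteq> twist p ?N"
      by (rule K.twist_mono[OF high(2)], rule K.twist_mono[OF high(3)])
    have "{0} \<subseteq> twist p (H ?l)" using rmod.subspace_0[OF K.submodule_twist, of "H ?l"] by simp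
    from K.split_module_quotient(2)[OF spl(2) K.split_module_0 this]
    obtain u1 where u1: "quotient_basis (twist p (H ?l)) {0} (d ?l - 0) u1" by (elim exE)
    have Ki': "Ki = {x \<in> E i. Ve *v x \<in> {0}}" unfolding Ki by simp
    \<comment> \<open>Here E i / T is built from E i / Ki, of rank d, and Ki / T, of rank \<delta> -
      d.\<close>
    obtain u2 where u2: "quotient_basis (E i) Ki (d ?l - 0) u2"
      by (rule quotient_basis_vimage[OF sub(1,4) im u1 Ki'])
    obtain u3 where u3: "quotient_basis (twist p (E ?l)) (twist p ?N) (h - (h + d ?l - ?\<delta>)) u3"
      using K.split_module_quotient(2)[OF spl(1) sN N(1)] by (elim exE)
    have KT: "quotient_basis Ki ?T (h - (h + d ?l - ?\<delta>)) (\<lambda>a. Fr *v u3 a)"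
      unfolding T Ki_def
      by (rule quotient_basis_image[OF K.submodule_twist K.submodule_twist N(1) _ u3])
        (rule subsetD[OF N(2) ker])
    have TK: "?T \<subseteq> Ki" unfolding T Ki_def using N(1) by (rule image_mono)
    have KE: "Ki \<subseteq> E i" unfolding Ki by (rule Collect_restrict)
    note ET = quotient_basis_trans[OF sub(2,3,1) TK KE u2 KT]
    have e: "d ?l - 0 + (h - (h + d ?l - ?\<delta>)) = ?\<delta>" using b(2) b(4)[OF lt] by simp
    \<comment> \<open>\<open>Fr\<close> kills exactly the twist of the previous \<open>H\<close>,
      which lies in that of \<open>Fil\<close>; the image \<open>T\<close> is their
      quotient.\<close>
    obtain u4 where u4: "quotient_basis (twist p ?N) (twist p (H ?l)) (h + d ?l - ?\<delta> - d ?l) u4"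
      using K.split_module_quotient(2)[OF sN spl(2) N(2)] by (elim exE)
    have T0: "quotient_basis ?T {0} (h + d ?l - ?\<delta> - d ?l) (\<lambda>a. Fr *v u4 a)"
      unfolding T Fr0[symmetric]
      by (rule quotient_basis_image[OF K.submodule_twist K.submodule_twist N(2) _ u4])
        (rule ker[OF subsetD[OF N(1)]])
    have e': "h + d ?l - ?\<delta> - d ?l = h - ?\<delta>" by simp
    show ?thesis by (rule conjI, rule exI, rule ET[unfolded e], rule exI, rule T0[unfolded e'])
  qed
  then show "\<exists>u. quotient_basis (E i) ?T ?\<delta> u" "\<exists>u. quotient_basis ?T {0} (h - ?\<delta>) u"
    by (rule conjunct1, rule conjunct2)
qed

section \<open>Propagation of congruences along the cycle\<close>

text \<open>On the Frobenius side matrices preserve smallness. On the Verschiebung side the small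
  error lies in the twist of the previous \<open>H\<close>, the image of \<open>E i\<close>; a small
  lift of it is subtracted from x.\<close>

lemma close_tilde:
  assumes ad: "hodge_adequate Fil" "hodge_adequate Fil'" and i: "i \<in> {1..f}" and j: "j \<in> {1..jump_count f h d}"
    and t: "t \<le> 1" and cl: "K.close t (Fil (prv f i) j) (Fil' (prv f i) j)"
  shows "K.close t (tilde Fil i j) (tilde Fil' i j)"
  unfolding K.close_def
proof
  let ?l = "prv f i"
  note l = prv_mem[OF i]
  have tw: "K.close t (twist p (Fil ?l j)) (twist p (Fil' ?l j))" by (rule K.close_twist[OF t cl])
  fix x assume x: "x \<in> tilde Fil i j"
  show "\<exists>y\<in>tilde Fil' i j. x - y \<in> K.small t"
  proof (cases "j \<le> jump_index f h d ?l")
    case True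
    have xE: "x \<in> E i" and "Ve *v x \<in> twist p (Fil ?l j)" using x True by (simp_all add: fil_tilde_def)
    then obtain y where y: "y \<in> twist p (Fil' ?l j)" "Ve *v x - y \<in> K.small t"
      using tw unfolding K.close_def by blast
    have im: "(*v) Ve ` E i = twist p (H ?l)" by (rule Ve_image[OF jump_bounds(1)[OF i j] i])
    have "y \<in> twist p (H ?l)" using y(1) K.twist_mono[OF adequate_low(2)[OF ad(2) l j True]] by blast
    moreover have "Ve *v x \<in> twist p (H ?l)" using im xE by blast
    ultimately have "Ve *v x - y \<in> twist p (H ?l)" by (intro rmod.subspace_diff[OF K.submodule_twist])
    then obtain z where z: "z \<in> E i" "z \<in> K.small t" "Ve *v z = Ve *v x - y"
      by (rule K.small_lift[OF K.split_module_twist[OF split_H[OF l]] im submodule_E _ y(2) t])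
    have "x - z \<in> E i" by (rule rmod.subspace_diff[OF submodule_E xE z(1)])
    then have "x - z \<in> tilde Fil' i j" using True y(1) z(3) by (simp add: fil_tilde_def matrix_vector_diff)
    then show ?thesis using z(2) by (intro bexI[of _ "x - z"]) simp_all
  next
    case False
    then obtain n where n: "n \<in> twist p (Fil ?l j)" "x = Fr *v n" using x by (auto simp: fil_tilde_def)
    then obtain n' where n': "n' \<in> twist p (Fil' ?l j)" "n - n' \<in> K.small t"
      using tw unfolding K.close_def by blast
    have "Fr *v (n - n') \<in> K.small t" by (rule K.small_matrix[OF t n'(2)])
    then show ?thesis using False n n' by (auto simp: fil_tilde_def matrix_vector_diff)
  qed
qed

abbreviation hasse :: "(nat \<Rightarrow> nat \<Rightarrow> ('r ^ 'n) set) \<Rightarrow> nat \<Rightarrow> nat \<Rightarrow> real" where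
  "hasse Fil i j \<equiv> red_val v red (hasse_det p f h d Fr Ve E H Fil i j)"

text \<open>The two ranges of \<open>j\<close> work in opposite directions. For j \<le> s i,
  \<open>Fil'\<close> lies in its own tilde module, which is close to that of \<open>Fil\<close>.
  For j > s i, the tilde module of \<open>Fil\<close> is close to that of \<open>Fil'\<close>, which
  lies in \<open>Fil'\<close>; so the hypothesis and the result both have to be reversed. In both
  ranges the determinant is that of \<open>Fil\<close>.\<close>

lemma close_step:
  assumes ad: "hodge_adequate Fil" "hodge_adequate Fil'" and i: "i \<in> {1..f}" and j: "j \<in> {1..jump_count f h d}"
    and t: "0 < t - hasse Fil i j" "t \<le> 1" and cl: "K.close t (Fil' (prv f i) j) (Fil (prv f i) j)"
  shows "K.close (t - hasse Fil i j) (Fil' i j) (Fil i j)"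
proof -
  let ?T = "tilde Fil i j" let ?T' = "tilde Fil' i j"
  have t0: "0 < t" using t(1) K.\<nu>_nonneg[of "hasse_det p f h d Fr Ve E H Fil i j"] by linarith
  note b = jump_bounds[OF i j]
  obtain e where e: "quotient_basis (E i) ?T (jump f h d j) e" using tilde_quotient_bases(1)[OF ad(1) i j] by blast
  obtain e' where e': "quotient_basis ?T {0} (h - jump f h d j) e'" using tilde_quotient_bases(2)[OF ad(1) i j] by blast
  show ?thesis
  proof (cases "j \<le> jump_index f h d i")
    case True
    note low = adequate_low[OF ad(1) i j True] and low' = adequate_low[OF ad(2) i j True]
    have "d i - (d i - jump f h d j) = jump f h d j" using b(3)[OF True] by simp
    then obtain u where u: "quotient_basis (H i) (Fil i j) (jump f h d j) u"
      using K.split_module_quotient(2)[OF split_H[OF i] low(1,2)] by auto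
    have "K.close t (Fil' i j) ?T"
      by (rule K.close_mono[OF close_tilde[OF ad(2,1) i j t(2) cl] order_refl low'(3) order_refl])
    from K.natural_det_close_subset[OF submodule_tilde split_E[OF i] H_subset_E low(3) tilde_subset_E[OF ad(1) i j]
        low'(2) u e t(2) this]
    show ?thesis using True by (simp add: hasse_det_def)
  next
    case False
    then have lt: "jump_index f h d i < j" by simp
    note high = adequate_high[OF ad(1) i j lt] and high' = adequate_high[OF ad(2) i j lt]
    have "h + d i - jump f h d j - d i = h - jump f h d j" by simp
    then obtain u where u: "quotient_basis (Fil i j) (H i) (h - jump f h d j) u"
      using K.split_module_quotient(2)[OF high(1) split_H[OF i] high(3)] by auto
    obtain k where k: "split_module (Fil (prv f i) j) k" "split_module (Fil' (prv f i) j) k"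
      by (rule adequate_split[OF ad prv_mem[OF i] j])
    have "K.close t (Fil (prv f i) j) (Fil' (prv f i) j)" by (rule K.close_sym[OF k t0 t(2) cl])
    then have "K.close t ?T (Fil' i j)"
      by (rule K.close_mono[OF close_tilde[OF ad i j t(2)] order_refl order_refl high'(4)])
    from K.natural_det_close_supset[OF split_module_submodule[OF split_H[OF i]] split_module_submodule[OF high'(1)]
        high'(1) high(4) high'(3) t(2) e' u submodule_tilde this split_module_UNIV]
    have "K.close (t - hasse Fil i j) (Fil i j) (Fil' i j)" using False by (simp add: hasse_det_def)
    moreover have "t - hasse Fil i j \<le> 1"
      using t(2) K.\<nu>_nonneg[of "hasse_det p f h d Fr Ve E H Fil i j"] by linarith
    ultimately show ?thesis using K.close_sym[OF high'(1) high(1) t(1)] by blast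
  qed
qed

lemma close_filtrations:
  assumes ad: "hodge_adequate Fil" "hodge_adequate Fil'" and j: "j \<in> {1..jump_count f h d}"
    and w: "(\<Sum>i=1..f. hasse Fil i j) \<le> w" "w < 1" and i: "i \<in> {1..f}"
  shows "K.close (1 - w) (Fil' i j) (Fil i j)"
proof -
  define W where "W i = hasse Fil i j" for i
  have W: "0 \<le> W i" for i unfolding W_def by (rule K.\<nu>_nonneg)
  have le: "sum W A \<le> w" if "A \<subseteq> {1..f}" for A
    using sum_mono2[OF _ that, of W] W w(1) by (auto simp: W_def)
  \<comment> \<open>Every jump is, by construction, some d i0.\<close>
  obtain i0 where i0: "i0 \<in> {1..f}" "d i0 = jump f h d j" using jump_nth[OF j] by auto
  have "jump_index f h d i0 = j" by (rule jump_index_eqI[OF jump_bounds(1)[OF i0(1) j]]) (use i0 j in auto)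
  then have "Fil i0 j = {0}" "Fil' i0 j = {0}"
    using ad[unfolded adequate_def Let_def] i0(1) j by auto
  then have base: "K.close 1 (Fil' i0 j) (Fil i0 j)" by (simp add: K.close_def K.small_def)
  \<comment> \<open>The loss is recorded as a sum over the set of indices already passed; a new
    index must lie outside it, so no invariant is charged twice and the total stays at most w <
    1.\<close>
  have advance: "K.close (1 - sum W (insert i A)) (Fil' i j) (Fil i j)"
    if "K.close (1 - sum W A) (Fil' (prv f i) j) (Fil (prv f i) j)" "i \<in> {1..f}" "A \<subseteq> {1..f}" "i \<notin> A" for i A
  proof -
    have "finite A" using that(3) by (rule finite_subset) simp
    then have eq: "1 - sum W (insert i A) = 1 - sum W A - hasse Fil i j" using that(4) by (simp add: W_def)
    have "0 \<le> sum W A" using W by (rule sum_nonneg)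
    moreover have "sum W (insert i A) < 1" using le[of "insert i A"] that w(2) by simp
    ultimately show ?thesis unfolding eq
      by (intro close_step[OF ad that(2) j _ _ that(1)]) (use eq in linarith)+
  qed
  have up: "K.close (1 - sum W {i0<..i}) (Fil' i j) (Fil i j)" if "i0 \<le> i" "i \<le> f" for i
    using that
  proof (induction i rule: dec_induct)
    case base
    show ?case using \<open>K.close 1 (Fil' i0 j) (Fil i0 j)\<close> by simp
  next
    case (step i)
    have prv: "prv f (Suc i) = i" using step(1) i0(1) by (simp add: prv_def)
    have "K.close (1 - sum W (insert (Suc i) {i0<..i})) (Fil' (Suc i) j) (Fil (Suc i) j)"
    proof (rule advance)
      show "K.close (1 - sum W {i0<..i}) (Fil' (prv f (Suc i)) j) (Fil (prv f (Suc i)) j)"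
        using step by (simp add: prv)
      show "{i0<..i} \<subseteq> {1..f}" using step.prems i0(1) by (intro subsetI) simp
    qed (use step.prems in simp_all)
    moreover have "insert (Suc i) {i0<..i} = {i0<..Suc i}" using step(1) by auto
    ultimately show ?case by simp
  qed
  \<comment> \<open>The indices before i0 are reached after passing from \<open>f\<close> to 1; i0
    itself is never charged.\<close>
  have around: "K.close (1 - sum W ({i0<..f} \<union> {1..i})) (Fil' i j) (Fil i j)" if "1 \<le> i" "i < i0" for i
    using that
  proof (induction i rule: dec_induct)
    case base
    have "K.close (1 - sum W (insert 1 {i0<..f})) (Fil' 1 j) (Fil 1 j)"
    proof (rule advance)
      show "K.close (1 - sum W {i0<..f}) (Fil' (prv f 1) j) (Fil (prv f 1) j)"
        using up[of f] i0(1) by (simp add: prv_def)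
      show "{i0<..f} \<subseteq> {1..f}" using i0(1) by (intro subsetI) simp
    qed (use base i0(1) in simp_all)
    then show ?case by (simp add: Un_commute)
  next
    case (step i)
    have prv: "prv f (Suc i) = i" using step(1) by (simp add: prv_def)
    have "K.close (1 - sum W (insert (Suc i) ({i0<..f} \<union> {1..i}))) (Fil' (Suc i) j) (Fil (Suc i) j)"
    proof (rule advance)
      show "K.close (1 - sum W ({i0<..f} \<union> {1..i})) (Fil' (prv f (Suc i)) j) (Fil (prv f (Suc i)) j)"
        using step by (simp add: prv)
      show "{i0<..f} \<union> {1..i} \<subseteq> {1..f}" using step.prems i0(1) by (intro subsetI) auto
    qed (use step.prems i0(1) in simp_all)
    moreover have "insert (Suc i) ({i0<..f} \<union> {1..i}) = {i0<..f} \<union> {1..Suc i}" by auto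
    ultimately show ?case by simp
  qed
  obtain A where A: "A \<subseteq> {1..f}" "K.close (1 - sum W A) (Fil' i j) (Fil i j)"
  proof (cases "i0 \<le> i")
    case True
    show ?thesis by (rule that[OF _ up[OF True]]) (use i i0 in auto)
  next
    case False
    show ?thesis by (rule that[OF _ around]) (use i i0 False in auto)
  qed
  have "1 - w \<le> 1 - sum W A" using le[OF A(1)] by simp
  then show ?thesis by (rule K.close_mono[OF A(2) _ order_refl order_refl])
qed

text \<open>Both modules lie in \<open>E i\<close>, so a small difference of their elements is a
  small element of \<open>E i\<close>; it then belongs to \<open>ideal_times\<close> and the cosets
  coincide.\<close>

lemma reduction_subset:
  assumes i: "i \<in> {1..f}" and N: "N \<subseteq> E i" "N' \<subseteq> E i" and t: "t \<le> 1" and cl: "K.close t N N'"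
  shows "reduction v red t (E i) N \<subseteq> reduction v red t (E i) N'"
proof
  let ?I = "ideal_times v red t (E i)"
  have I: "submodule ?I" unfolding ideal_times_def by simp
  fix c assume "c \<in> reduction v red t (E i) N"
  then obtain x where x: "x \<in> N" "c = {x + z |z. z \<in> ?I}" unfolding reduction_def by blast
  then obtain y where y: "y \<in> N'" "x - y \<in> K.small t" using cl unfolding K.close_def by blast
  have "x - y \<in> E i" using x(1) y(1) N by (intro rmod.subspace_diff[OF submodule_E]) auto
  then have xy: "x - y \<in> ?I" using K.small_subset_ideal_times[OF split_E[OF i] _ y(2) t] by blast
  have "{x + z |z. z \<in> ?I} = {y + z |z. z \<in> ?I}"
  proof (intro equalityI subsetI)
    fix c assume "c \<in> {x + z |z. z \<in> ?I}"
    then obtain z where z: "c = x + z" "z \<in> ?I" by blast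
    have "x - y + z \<in> ?I" by (rule rmod.subspace_add[OF I xy z(2)])
    moreover have "c = y + (x - y + z)" using z(1) by simp
    ultimately show "c \<in> {y + z |z. z \<in> ?I}" by blast
  next
    fix c assume "c \<in> {y + z |z. z \<in> ?I}"
    then obtain z where z: "c = y + z" "z \<in> ?I" by blast
    have "z - (x - y) \<in> ?I" by (rule rmod.subspace_diff[OF I z(2) xy])
    moreover have "c = x + (z - (x - y))" using z(1) by simp
    ultimately show "c \<in> {x + z |z. z \<in> ?I}" by blast
  qed
  then show "c \<in> reduction v red t (E i) N'" using x(2) y(1) unfolding reduction_def by blast
qed

end

theorem proposition3p2p2:
  fixes p f h :: nat
    and vQ :: "'q::field_char_0 \<Rightarrow> ereal"
    and jF :: "'q \<Rightarrow> 'f::field_char_0" and vF :: "'f \<Rightarrow> ereal"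
    and res :: "'f \<Rightarrow> 'c::{field,finite}" and \<sigma> :: "'f \<Rightarrow> 'f"
    and jK :: "'q \<Rightarrow> 'k::field_char_0" and v :: "'k \<Rightarrow> ereal"
    and red :: "'k \<Rightarrow> 'r::comm_ring_1" and \<kappa> :: "'c \<Rightarrow> 'r"
    and Fr Ve :: "'r ^ 'n ^ 'n" and \<omega> :: "('r ^ 'n) set" and \<rho> :: "'f \<Rightarrow> 'r ^ 'n ^ 'n"
    and d :: "nat \<Rightarrow> nat" and E H :: "nat \<Rightarrow> ('r ^ 'n) set"
    and Fil Fil' :: "nat \<Rightarrow> nat \<Rightarrow> ('r ^ 'n) set"
    and w :: real
  assumes "dieudonne_module p vQ jF vF f res \<sigma> jK v red \<kappa> Fr Ve \<omega> \<rho> h d E H"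
    and "adequate p f h d Fr Ve E H Fil"
    and "w = (\<Sum>i=1..f. \<Sum>j=1..jump_count f h d.
                red_val v red (hasse_det p f h d Fr Ve E H Fil i j))"
    and "w < 1"
    and "adequate p f h d Fr Ve E H Fil'"
  shows "\<forall>i\<in>{1..f}. \<forall>j\<in>{1..jump_count f h d}.
           reduction v red (1 - w) (E i) (Fil' i j) = reduction v red (1 - w) (E i) (Fil i j)"
proof (intro ballI)
  interpret dieudonne_module p vQ jF vF f res \<sigma> jK v red \<kappa> Fr Ve \<omega> \<rho> h d E H by fact
  fix i j assume i: "i \<in> {1..f}" and j: "j \<in> {1..jump_count f h d}"
  note ad = assms(2,5)
  \<comment> \<open>Only the invariants of the given \<open>j\<close> are lost on the way round; the
    remaining terms of w are nonnegative.\<close>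
  have "(\<Sum>i=1..f. hasse Fil i j) \<le> w" unfolding assms(3)
    by (intro sum_mono member_le_sum j K.\<nu>_nonneg) simp
  then have cl: "K.close (1 - w) (Fil' i j) (Fil i j)" by (rule close_filtrations[OF ad j _ assms(4) i])
  have w: "0 < 1 - w" "1 - w \<le> 1" using assms(4) unfolding assms(3) by (auto intro!: sum_nonneg K.\<nu>_nonneg)
  obtain k where k: "split_module (Fil i j) k" "split_module (Fil' i j) k"
    by (rule adequate_split[OF ad i j])
  note sub = adequate_subset_E[OF ad(2) i j] adequate_subset_E[OF ad(1) i j]
  show "reduction v red (1 - w) (E i) (Fil' i j) = reduction v red (1 - w) (E i) (Fil i j)"
    using reduction_subset[OF i sub w(2) cl] reduction_subset[OF i sub(2,1) w(2) K.close_sym[OF k w cl]]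
    by (rule equalityI)
qed

end
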